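(* Let $G$ be a countably infinite amenable group and $(F_N)_{N\in\mathbb{N}}$ a right-F\o lner sequence in $G$. Let $\mathcal{H}$ be a Hilbert space and let $u:G\to\mathcal{H}$ satisfy $\sup_{g\in G}\|u(g)\|<\infty$. If $$\sum_{h\in G}\limsup_{N\rightarrow\infty}\left|\frac{1}{|F_N|}\sum_{g\in F_N}\langle u(gh),u(g)\rangle\right|^2<\infty,$$ then $u$ is spectrally Lebesgue.
   Context: Groups are discrete; Hilbert spaces are complex and separable. A right-F\o lner sequence in $G$ is a sequence of finite sets $F_n\subseteq G$ with $\lim_n|F_n\triangle F_ng|/|F_n|=0$ for all $g\in G$; $G$ is amenable if it has one. The Hilbert space of a permissible pair. Fix $(F_n)$. Let $SA(\mathcal{H},(F_n))$ be the set of $f:G\to\mathcal{H}$ with $\limsup_N\frac1{|F_N|}\sum_{g\in F_N}\|f(g)\|^2<\infty$, and $UB(\mathcal{H})$ the set of $f:G\to\mathcal{H}$ with $\sup_g\|f(g)\|<\infty$. Let $I$ be countable, $\{f_n\}_{n\in I}\subseteq SA(\mathcal{H},(F_n))$, and $(N_q)_{q=1}^\infty$ an increasing sequence of positive integers. The pair $P=(\{f_n\}_{n\in I},(F_{N_q})_{q=1}^\infty)$ is a permissible pair if $\langle x,y\rangle_{\mathscr{H}}:=\lim_{q\to\infty}\frac1{|F_{N_q}|}\sum_{g\in F_{N_q}}\langle x(g),y(g)\rangle$ exists for all $x,y\in\{f_n\}_{n\in I}$. Let $\mathscr{H}'$ be the linear span of $\{f_n\}_{n\in I}$ (pointwise operations);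 let $\mathscr{H}''$ be the set of $E\in SA(\mathcal{H},(F_{N_q}))$ such that for every $\epsilon>0$ there is $E_\epsilon\in\mathscr{H}'$ with $\limsup_q\frac1{|F_{N_q}|}\sum_{g\in F_{N_q}}\|E(g)-E_\epsilon(g)\|^2<\epsilon$; let $S=\{x\in\mathscr{H}'':\lim_q\frac1{|F_{N_q}|}\sum_{g\in F_{N_q}}\|x(g)\|^2=0\}$. The same limit formula defines $\langle\cdot,\cdot\rangle_{\mathscr{H}}$ on $\mathscr{H}''$, and $\mathscr{H}(P):=\mathscr{H}''/S$, which is a Hilbert space. For $h\in G$ and $f:G\to\mathcal{H}$ put $(U_hf)(g)=f(gh)$. If $u\in UB(\mathcal{H})$ and $P=(\{U_gu\}_{g\in G},(F_{N_q}))$ is permissible, then $h\mapsto U_h$ induces a unitary representation $U$ of $G$ on $\mathscr{H}(P)$. A function $u\in UB(\mathcal{H})$ is spectrally Lebesgue (relative to $(F_n)$) if for every permissible pair $P=(\{U_gu\}_{g\in G},(F_{N_q})_{q=1}^\infty)$ the representation $U$ of $G$ on $\mathscr{H}(P)$ is unitarily equivalent to a subrepresentation of the left regular representation of $G$ on $\ell^2(G)$, $(L(g)f)(x)=f(g^{-1}x)$. *)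

theory Defs
  imports "HOL-Analysis.Analysis" "HOL-Library.Function_Algebras"
begin

text \<open>
  Groups are types of class \<^class>\<open>group_add\<close>. Addition in this class need not be commutative:
  \<open>g + h\<close> stands for the product \<open>gh\<close> and \<open>- g\<close> for the inverse.
\<close>

section \<open>Complex inner product spaces\<close>

text \<open>
  The inner product is linear in the first argument. Positive definiteness is a consequence of
  the axiom for the norm. A Hilbert space is a type of class \<open>complex_inner\<close> that is also in
  \<^class>\<open>complete_space\<close>.
\<close>

class complex_inner = real_normed_vector +
  fixes scaleC :: "complex \<Rightarrow> 'a \<Rightarrow> 'a" (infixr "*\<^sub>C" 75)
    and cinner :: "'a \<Rightarrow> 'a \<Rightarrow> complex"
  assumes scaleC_add_right: "a *\<^sub>C (x + y) = a *\<^sub>C x + a *\<^sub>C y"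
    and scaleC_add_left: "(a + b) *\<^sub>C x = a *\<^sub>C x + b *\<^sub>C x"
    and scaleC_scaleC: "a *\<^sub>C (b *\<^sub>C x) = (a * b) *\<^sub>C x"
    and scaleR_scaleC: "r *\<^sub>R x = complex_of_real r *\<^sub>C x"
    and cinner_commute: "cinner x y = cnj (cinner y x)"
    and cinner_add_left: "cinner (x + y) z = cinner x z + cinner y z"
    and cinner_scaleC_left: "cinner (a *\<^sub>C x) y = a * cinner x y"
    and norm_eq_sqrt_cinner: "norm x = sqrt (Re (cinner x x))"

lemma scaleC_one: "1 *\<^sub>C x = (x :: 'a :: complex_inner)"
  using scaleR_scaleC[of 1 x] by simp

instantiation complex :: complex_inner
begin

definition scaleC_complex_def: "a *\<^sub>C (x :: complex) = a * x"
definition cinner_complex_def: "cinner x (y :: complex) = x * cnj y"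

instance
  by standard (auto simp: scaleC_complex_def cinner_complex_def algebra_simps scaleR_conv_of_real
      cmod_def power2_eq_square)

end

definition fun_scaleC :: "complex \<Rightarrow> ('g \<Rightarrow> 'h :: complex_inner) \<Rightarrow> ('g \<Rightarrow> 'h)" where
  "fun_scaleC c f = (\<lambda>g. c *\<^sub>C f g)"

global_interpretation cfun: vector_space "fun_scaleC :: complex \<Rightarrow> ('g \<Rightarrow> 'h :: complex_inner) \<Rightarrow> _"
  by standard
    (auto simp: fun_scaleC_def fun_eq_iff scaleC_add_right scaleC_add_left scaleC_scaleC scaleC_one)

section \<open>Unitary representations\<close>

text \<open>
  A complex inner product space on a carrier set, used for \<open>\<H>(P)\<close>, \<open>\<ell>\<^sup>2(G)\<close> and its subspaces.
\<close>

record 'a ip_space =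
  carrier :: "'a set"
  vadd :: "'a \<Rightarrow> 'a \<Rightarrow> 'a"
  vscale :: "complex \<Rightarrow> 'a \<Rightarrow> 'a"
  vinner :: "'a \<Rightarrow> 'a \<Rightarrow> complex"

definition vdist :: "'a ip_space \<Rightarrow> 'a \<Rightarrow> 'a \<Rightarrow> real" where
  "vdist K x y = (let d = vadd K x (vscale K (- 1) y) in sqrt (Re (vinner K d d)))"

definition unitary_map :: "'a ip_space \<Rightarrow> 'b ip_space \<Rightarrow> ('a \<Rightarrow> 'b) \<Rightarrow> bool" where
  "unitary_map K L V \<longleftrightarrow>
     bij_betw V (carrier K) (carrier L) \<and>
     (\<forall>x\<in>carrier K. \<forall>y\<in>carrier K. V (vadd K x y) = vadd L (V x) (V y)) \<and>
     (\<forall>c. \<forall>x\<in>carrier K. V (vscale K c x) = vscale L c (V x)) \<and>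
     (\<forall>x\<in>carrier K. \<forall>y\<in>carrier K. vinner L (V x) (V y) = vinner K x y)"

definition unitary_rep :: "'a ip_space \<Rightarrow> ('g :: group_add \<Rightarrow> 'a \<Rightarrow> 'a) \<Rightarrow> bool" where
  "unitary_rep K \<rho> \<longleftrightarrow>
     (\<forall>g. unitary_map K K (\<rho> g)) \<and>
     (\<forall>g h. \<forall>x\<in>carrier K. \<rho> (g + h) x = \<rho> g (\<rho> h x))"

definition unitarily_equivalent ::
  "'a ip_space \<Rightarrow> ('g \<Rightarrow> 'a \<Rightarrow> 'a) \<Rightarrow> 'b ip_space \<Rightarrow> ('g \<Rightarrow> 'b \<Rightarrow> 'b) \<Rightarrow> bool" where
  "unitarily_equivalent K \<rho> L \<sigma> \<longleftrightarrow>
     (\<exists>V. unitary_map K L V \<and> (\<forall>g. \<forall>x\<in>carrier K. V (\<rho> g x) = \<sigma> g (V x)))"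

definition closed_subspace :: "'a ip_space \<Rightarrow> 'a set \<Rightarrow> bool" where
  "closed_subspace K W \<longleftrightarrow>
     W \<subseteq> carrier K \<and> W \<noteq> {} \<and>
     (\<forall>x\<in>W. \<forall>y\<in>W. vadd K x y \<in> W) \<and>
     (\<forall>c. \<forall>x\<in>W. vscale K c x \<in> W) \<and>
     (\<forall>s x. (\<forall>n. s n \<in> W) \<and> x \<in> carrier K \<and> (\<lambda>n::nat. vdist K (s n) x) \<longlonglongrightarrow> 0 \<longrightarrow> x \<in> W)"

definition invariant_subspace :: "'a ip_space \<Rightarrow> ('g \<Rightarrow> 'a \<Rightarrow> 'a) \<Rightarrow> 'a set \<Rightarrow> bool" where
  "invariant_subspace K \<rho> W \<longleftrightarrow> closed_subspace K W \<and> (\<forall>g. \<rho> g ` W \<subseteq> W)"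

definition equivalent_to_subrep ::
  "'a ip_space \<Rightarrow> ('g \<Rightarrow> 'a \<Rightarrow> 'a) \<Rightarrow> 'b ip_space \<Rightarrow> ('g \<Rightarrow> 'b \<Rightarrow> 'b) \<Rightarrow> bool" where
  "equivalent_to_subrep K \<rho> L \<sigma> \<longleftrightarrow>
     (\<exists>W. invariant_subspace L \<sigma> W \<and> unitarily_equivalent K \<rho> (L\<lparr>carrier := W\<rparr>) \<sigma>)"

definition ell2 :: "('g \<Rightarrow> complex) ip_space" where
  "ell2 = \<lparr>carrier = {f. (\<lambda>x. (cmod (f x))\<^sup>2) summable_on UNIV},
     vadd = (\<lambda>f f' x. f x + f' x),
     vscale = (\<lambda>c f x. c * f x),
     vinner = (\<lambda>f f'. \<Sum>\<^sub>\<infinity>x. f x * cnj (f' x))\<rparr>"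

definition left_regular :: "'g :: group_add \<Rightarrow> ('g \<Rightarrow> complex) \<Rightarrow> ('g \<Rightarrow> complex)" where
  "left_regular g f = (\<lambda>x. f (- g + x))"

section \<open>Averages along a right-F\o lner sequence\<close>

text \<open>The sets are required to be nonempty, as division by zero gives zero in HOL.\<close>

definition right_folner :: "(nat \<Rightarrow> 'g :: group_add set) \<Rightarrow> bool" where
  "right_folner F \<longleftrightarrow>
     (\<forall>n. finite (F n) \<and> F n \<noteq> {}) \<and>
     (\<forall>g. (\<lambda>n. real (card (sym_diff (F n) ((\<lambda>x. x + g) ` F n))) / real (card (F n))) \<longlonglongrightarrow> 0)"

definition amenable :: "'g :: group_add itself \<Rightarrow> bool" where
  "amenable _ \<longleftrightarrow> (\<exists>F :: nat \<Rightarrow> 'g set. right_folner F)"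

definition avg :: "'g set \<Rightarrow> ('g \<Rightarrow> 'b :: field) \<Rightarrow> 'b" where
  "avg A f = (\<Sum>g\<in>A. f g) / of_nat (card A)"

definition limsup_norm2 :: "(nat \<Rightarrow> 'g set) \<Rightarrow> ('g \<Rightarrow> 'h :: complex_inner) \<Rightarrow> ennreal" where
  "limsup_norm2 F f = limsup (\<lambda>n. ennreal (avg (F n) (\<lambda>g. (norm (f g))\<^sup>2)))"

definition SA :: "(nat \<Rightarrow> 'g set) \<Rightarrow> ('g \<Rightarrow> 'h :: complex_inner) set" where
  "SA F = {f. limsup_norm2 F f < \<infinity>}"

definition UB :: "('g \<Rightarrow> 'h :: complex_inner) set" where
  "UB = {f. bounded (range f)}"

definition avg_inner :: "(nat \<Rightarrow> 'g set) \<Rightarrow> ('g \<Rightarrow> 'h :: complex_inner) \<Rightarrow> ('g \<Rightarrow> 'h) \<Rightarrow> nat \<Rightarrow> complex" where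
  "avg_inner F x y n = avg (F n) (\<lambda>g. cinner (x g) (y g))"

section \<open>The Hilbert space of a permissible pair\<close>

text \<open>
  The family of functions enters only through its range \<open>A\<close>, and the sequence \<open>(F_{N_q})\<close> is
  \<open>F \<circ> N\<close>. In the constants below that take \<open>A\<close> and \<open>\<Phi>\<close>, the latter is this subsequence.
\<close>

definition permissible ::
  "(nat \<Rightarrow> 'g set) \<Rightarrow> ('g \<Rightarrow> 'h :: complex_inner) set \<Rightarrow> (nat \<Rightarrow> nat) \<Rightarrow> bool" where
  "permissible F A N \<longleftrightarrow>
     countable A \<and> A \<subseteq> SA F \<and> strict_mono N \<and>
     (\<forall>x\<in>A. \<forall>y\<in>A. convergent (avg_inner (F \<circ> N) x y))"

definition pre_space :: "('g \<Rightarrow> 'h :: complex_inner) set \<Rightarrow> ('g \<Rightarrow> 'h) set" where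
  "pre_space A = cfun.span A"

definition ext_space ::
  "('g \<Rightarrow> 'h :: complex_inner) set \<Rightarrow> (nat \<Rightarrow> 'g set) \<Rightarrow> ('g \<Rightarrow> 'h) set" where
  "ext_space A \<Phi> =
     {E \<in> SA \<Phi>. \<forall>\<epsilon>>0. \<exists>E'\<in>pre_space A. limsup_norm2 \<Phi> (\<lambda>g. E g - E' g) < ennreal \<epsilon>}"

definition null_space ::
  "('g \<Rightarrow> 'h :: complex_inner) set \<Rightarrow> (nat \<Rightarrow> 'g set) \<Rightarrow> ('g \<Rightarrow> 'h) set" where
  "null_space A \<Phi> = {x \<in> ext_space A \<Phi>. (\<lambda>q. avg (\<Phi> q) (\<lambda>g. (norm (x g))\<^sup>2)) \<longlonglongrightarrow> 0}"

definition null_rel ::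
  "('g \<Rightarrow> 'h :: complex_inner) set \<Rightarrow> (nat \<Rightarrow> 'g set) \<Rightarrow> (('g \<Rightarrow> 'h) \<times> ('g \<Rightarrow> 'h)) set" where
  "null_rel A \<Phi> =
     {(x, y). x \<in> ext_space A \<Phi> \<and> y \<in> ext_space A \<Phi> \<and> (\<lambda>g. x g - y g) \<in> null_space A \<Phi>}"

definition cls ::
  "('g \<Rightarrow> 'h :: complex_inner) set \<Rightarrow> (nat \<Rightarrow> 'g set) \<Rightarrow> ('g \<Rightarrow> 'h) \<Rightarrow> ('g \<Rightarrow> 'h) set" where
  "cls A \<Phi> x = null_rel A \<Phi> `` {x}"

definition pair_space ::
  "('g \<Rightarrow> 'h :: complex_inner) set \<Rightarrow> (nat \<Rightarrow> 'g set) \<Rightarrow> ('g \<Rightarrow> 'h) set ip_space" where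
  "pair_space A \<Phi> = \<lparr>carrier = ext_space A \<Phi> // null_rel A \<Phi>,
     vadd = (\<lambda>X Y. \<Union>x\<in>X. \<Union>y\<in>Y. cls A \<Phi> (\<lambda>g. x g + y g)),
     vscale = (\<lambda>c X. \<Union>x\<in>X. cls A \<Phi> (\<lambda>g. c *\<^sub>C x g)),
     vinner = (\<lambda>X Y. the_elem (\<Union>x\<in>X. \<Union>y\<in>Y. {lim (avg_inner \<Phi> x y)}))\<rparr>"

section \<open>Spectrally Lebesgue functions\<close>

definition shift :: "'g :: group_add \<Rightarrow> ('g \<Rightarrow> 'h) \<Rightarrow> ('g \<Rightarrow> 'h)" where
  "shift h f = (\<lambda>g. f (g + h))"

text \<open>
  Translation need not map \<open>ext_space\<close> to itself or preserve \<open>null_space\<close>: a function in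
  \<open>null_space\<close> is unrestricted off the sets \<open>\<Phi> q\<close>, and its translate may fail to be in \<open>SA\<close>.
  On the span of the translates of a bounded function (whose elements are bounded) it acts
  isometrically. So the representation induced by \<open>h \<mapsto> U_h\<close> is the one extending this action
  to the Hilbert space; as the classes of elements of \<open>pre_space\<close> are dense, it is unique.
\<close>

definition induced_rep ::
  "('g :: group_add \<Rightarrow> 'h :: complex_inner) set \<Rightarrow> (nat \<Rightarrow> 'g set) \<Rightarrow>
     ('g \<Rightarrow> ('g \<Rightarrow> 'h) set \<Rightarrow> ('g \<Rightarrow> 'h) set) \<Rightarrow> bool" where
  "induced_rep A \<Phi> U \<longleftrightarrow>
     unitary_rep (pair_space A \<Phi>) U \<and>
     (\<forall>h. \<forall>x\<in>pre_space A. U h (cls A \<Phi> x) = cls A \<Phi> (shift h x))"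

definition spectrally_Lebesgue ::
  "(nat \<Rightarrow> 'g :: group_add set) \<Rightarrow> ('g \<Rightarrow> 'h :: complex_inner) \<Rightarrow> bool" where
  "spectrally_Lebesgue F u \<longleftrightarrow>
     u \<in> UB \<and>
     (\<forall>N. permissible F (range (\<lambda>g. shift g u)) N \<longrightarrow>
        (\<exists>U. induced_rep (range (\<lambda>g. shift g u)) (F \<circ> N) U \<and>
             equivalent_to_subrep (pair_space (range (\<lambda>g. shift g u)) (F \<circ> N)) U
               ell2 left_regular))"

end

(* If u has square-summable limiting correlations phi(h) = <U_h u, u>, then phi is a positive
   definite function in l^2(G), and it suffices to write phi(h) = <L(h) psi, psi> for some psi in
   l^2(G) (Godement): U_h u |-> L(h) psi then extends to an isometry of H(P) onto a closed invariant
   subspace of l^2(G).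

   To find psi, consider on the finitely supported functions the positive symmetric operator M with
   M delta_g = L(g) eta, where eta(x) = phi(x^-1). It may be unbounded, but the resolvent
   C = (1 + M)^-1 of its Friedrichs extension satisfies 0 <= C <= 1, commutes with L, and
   C w = delta_e for w = delta_e + eta. So psi = (1 - C)^(1/2) C^(1/2) w does it:
   <L(h) psi, psi> = <(1 - C) L(h) w, C w> = <L(h) eta, delta_e> = phi(h). *)
theory Submission
  imports Defs
begin

text \<open>Formally \<open>\<psi>\<close> is M^(1/2) delta_e: (1 - C)^(1/2) C^(1/2) equals M^(1/2)
  (1 + M)^(-1), and w = (1 + M) delta_e. A root of M itself is hard to reach, since \<phi> is merely
  square-summable and convolution by it need not map l^2 into itself; C and 1 - C are contractions,
  so their roots are norm limits of polynomials. The operator theory is done over the reals, and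
  complex linearity returns as commutation with multiplication by i. The other obstacle is that H(P)
  consists of classes of functions on G. To identify it with a closed subspace of l^2(G), every
  limit of images of the span has to be realised by an actual function. Gluing such a function
  together uses that finite sets are negligible for the averages, that is |F_N| -> \<infinity>, and
  this is where G being infinite enters. Positive definiteness of \<phi> is inherited from mean
  squares, and right invariance of the averages makes the limit of <U_g u, U_h u> depend on h^-1 g
  only.\<close>

section \<open>Square roots of positive operators\<close>

text \<open>A fixed point Y of this iteration satisfies (1 - Y)^2 = 1 - K, so the limit yields a
  square root of 1 - K.\<close>

primrec sqrt_iter :: "('a::real_normed_vector \<Rightarrow>\<^sub>L 'a) \<Rightarrow> nat \<Rightarrow> ('a \<Rightarrow>\<^sub>L 'a)" where
  "sqrt_iter K 0 = 0"
| "sqrt_iter K (Suc n) = (1/2) *\<^sub>R (K + (sqrt_iter K n o\<^sub>L sqrt_iter K n))"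

text \<open>The scalar iteration with \<open>K = 1\<close> dominates the operator iteration and makes it Cauchy in
  operator norm.\<close>

primrec sqrt_iter_bound :: "nat \<Rightarrow> real" where
  "sqrt_iter_bound 0 = 0"
| "sqrt_iter_bound (Suc n) = (1 + (sqrt_iter_bound n)\<^sup>2) / 2"

lemma sqrt_iter_bound_le_one: "0 \<le> sqrt_iter_bound n \<and> sqrt_iter_bound n \<le> 1"
  by (induction n) (auto simp: power_le_one)

lemma incseq_sqrt_iter_bound: "incseq sqrt_iter_bound"
proof (rule incseq_SucI)
  fix n
  have "0 \<le> (1 - sqrt_iter_bound n)\<^sup>2" by simp
  then show "sqrt_iter_bound n \<le> sqrt_iter_bound (Suc n)"
    by (simp add: power2_eq_square algebra_simps)
qed

lemma Cauchy_sqrt_iter_bound: "Cauchy sqrt_iter_bound"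
proof (rule convergent_Cauchy)
  show "convergent sqrt_iter_bound"
    by (rule incseq_convergent[OF incseq_sqrt_iter_bound, of 1])
      (use sqrt_iter_bound_le_one in \<open>auto simp: convergent_def\<close>)
qed

lemma blinfun_compose_assoc: "(a o\<^sub>L b) o\<^sub>L c = a o\<^sub>L (b o\<^sub>L c)"
  by (simp add: blinfun_eqI)

lemma commute_sqrt_iter:
  assumes "J o\<^sub>L K = K o\<^sub>L J"
  shows "J o\<^sub>L sqrt_iter K n = sqrt_iter K n o\<^sub>L J"
proof (induction n)
  case (Suc n)
  interpret bounded_bilinear "blinfun_compose :: ('a \<Rightarrow>\<^sub>L 'a) \<Rightarrow> _"
    by (rule bounded_bilinear_blinfun_compose)
  show ?case
    using Suc assms by (simp add: add_left add_right scaleR_left scaleR_right)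
      (metis blinfun_compose_assoc)
qed (simp add: blinfun_eqI)

lemma norm_sqrt_iter:
  assumes "norm K \<le> 1"
  shows "norm (sqrt_iter K n) \<le> sqrt_iter_bound n"
proof (induction n)
  case (Suc n)
  have "norm (sqrt_iter K n o\<^sub>L sqrt_iter K n) \<le> (sqrt_iter_bound n)\<^sup>2"
    using norm_blinfun_compose[of "sqrt_iter K n" "sqrt_iter K n"] Suc
    by (smt (verit) mult_mono norm_ge_zero power2_eq_square)
  then have "norm (K + (sqrt_iter K n o\<^sub>L sqrt_iter K n)) \<le> 1 + (sqrt_iter_bound n)\<^sup>2"
    using assms norm_triangle_ineq[of K "sqrt_iter K n o\<^sub>L sqrt_iter K n"] by linarith
  then show ?case by simp
qed simp

text \<open>Consecutive iterates commute, so X^2 - Y^2 = (X - Y)(X + Y) as for numbers, and the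
  induction copies the scalar computation factor by factor.\<close>

lemma norm_sqrt_iter_diff:
  assumes "norm K \<le> 1"
  shows "norm (sqrt_iter K (Suc n) - sqrt_iter K n) \<le> sqrt_iter_bound (Suc n) - sqrt_iter_bound n"
proof (induction n)
  case 0
  then show ?case using assms by simp
next
  case (Suc n)
  interpret bounded_bilinear "blinfun_compose :: ('a \<Rightarrow>\<^sub>L 'a) \<Rightarrow> _"
    by (rule bounded_bilinear_blinfun_compose)
  define X where "X = sqrt_iter K (Suc n)"
  define Y where "Y = sqrt_iter K n"
  define x where "x = sqrt_iter_bound (Suc n)"
  define y where "y = sqrt_iter_bound n"
  \<comment> \<open>Two uses of \<open>commute_sqrt_iter\<close>: an iterate commutes with K, hence
    with every other iterate.\<close>
  have comm: "X o\<^sub>L Y = Y o\<^sub>L X"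
    unfolding X_def Y_def by (metis commute_sqrt_iter)
  have "sqrt_iter K (Suc (Suc n)) - X = (1/2) *\<^sub>R ((X o\<^sub>L X) - (Y o\<^sub>L Y))"
    by (simp add: X_def Y_def scaleR_diff_right[symmetric])
  also have "(X o\<^sub>L X) - (Y o\<^sub>L Y) = (X - Y) o\<^sub>L (X + Y)"
    by (simp add: diff_left add_right comm)
  finally have "norm (sqrt_iter K (Suc (Suc n)) - X) = norm ((X - Y) o\<^sub>L (X + Y)) / 2" by simp
  also have "\<dots> \<le> (x - y) * (x + y) / 2"
  proof -
    have "norm (X - Y) \<le> x - y" using Suc by (simp add: X_def Y_def x_def y_def)
    moreover have "norm (X + Y) \<le> x + y"
      using norm_sqrt_iter[OF assms] norm_triangle_ineq[of X Y]
      unfolding X_def Y_def x_def y_def by (meson add_mono order_trans)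
    ultimately show ?thesis
      using norm_blinfun_compose[of "X - Y" "X + Y"]
      by (smt (verit) divide_right_mono mult_mono norm_ge_zero)
  qed
  also have "\<dots> = (1 + x\<^sup>2) / 2 - (1 + y\<^sup>2) / 2"
    by (simp add: power2_eq_square field_simps)
  also have "\<dots> = sqrt_iter_bound (Suc (Suc n)) - x"
    by (simp add: x_def y_def)
  finally show ?case by (simp only: X_def x_def)
qed

lemma norm_sqrt_iter_diff_le:
  assumes "norm K \<le> 1" "m \<le> n"
  shows "norm (sqrt_iter K n - sqrt_iter K m) \<le> sqrt_iter_bound n - sqrt_iter_bound m"
  using assms(2)
proof (induction n rule: dec_induct)
  case (step n)
  then show ?case
    using norm_sqrt_iter_diff[OF assms(1), of n]
      norm_triangle_ineq[of "sqrt_iter K (Suc n) - sqrt_iter K n" "sqrt_iter K n - sqrt_iter K m"]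
    by simp
qed simp

text \<open>S is a norm limit of polynomials in K with real coefficients, so it inherits
  self-adjointness and commutes with everything that commutes with K. The last clause is what
  carries translation invariance from the resolvent to its square roots.\<close>

lemma sqrt_id_minus_contraction:
  fixes K :: "'a::{real_inner,banach} \<Rightarrow>\<^sub>L 'a"
  assumes K: "norm K \<le> 1"
    and sa: "\<And>x y. inner (K x) y = inner x (K y)"
  obtains S :: "'a \<Rightarrow>\<^sub>L 'a"
  where "\<And>x. S (S x) = x - K x"
    and "\<And>x y. inner (S x) y = inner x (S y)"
    and "\<forall>J :: 'a \<Rightarrow>\<^sub>L 'a. (\<forall>x. J (K x) = K (J x)) \<longrightarrow> (\<forall>x. J (S x) = S (J x))"
proof -
  let ?Y = "sqrt_iter K"
  have "Cauchy ?Y"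
  proof (rule CauchyI)
    fix e :: real assume "0 < e"
    then obtain M where M: "\<forall>m\<ge>M. \<forall>n\<ge>M. norm (sqrt_iter_bound m - sqrt_iter_bound n) < e"
      using Cauchy_sqrt_iter_bound[THEN CauchyD] by blast
    have "norm (?Y m - ?Y n) < e" if "m \<ge> M" "n \<ge> M" for m n
    proof (cases m n rule: linorder_le_cases)
      case le
      then show ?thesis using norm_sqrt_iter_diff_le[OF K le] M that
        by (smt (verit) real_norm_def norm_minus_commute)
    next
      case ge
      then show ?thesis using norm_sqrt_iter_diff_le[OF K ge] M that
        by (smt (verit) real_norm_def)
    qed
    then show "\<exists>M. \<forall>m\<ge>M. \<forall>n\<ge>M. norm (?Y m - ?Y n) < e" by blast
  qed
  then obtain Y where Y: "?Y \<longlonglongrightarrow> Y" using Cauchy_convergent_iff convergent_def by blast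
  interpret bounded_bilinear "blinfun_compose :: ('a \<Rightarrow>\<^sub>L 'a) \<Rightarrow> _"
    by (rule bounded_bilinear_blinfun_compose)
  have "(\<lambda>n. ?Y (Suc n)) \<longlonglongrightarrow> (1/2) *\<^sub>R (K + (Y o\<^sub>L Y))"
    unfolding sqrt_iter.simps by (intro tendsto_intros tendsto Y)
  then have fixpt: "Y = (1/2) *\<^sub>R (K + (Y o\<^sub>L Y))"
    using LIMSEQ_unique LIMSEQ_Suc[OF Y] by blast
  have Yx: "(\<lambda>n. ?Y n x) \<longlonglongrightarrow> Y x" for x
    by (intro tendsto_intros Y)
  have iter_sa: "inner (?Y n x) y = inner x (?Y n y)" for n x y
    by (induction n arbitrary: x y)
      (simp_all add: blinfun.add_left blinfun.scaleR_left inner_add_left inner_add_right sa)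
  have Ysa: "inner (Y x) y = inner x (Y y)" for x y
  proof (rule LIMSEQ_unique)
    show "(\<lambda>n. inner (?Y n x) y) \<longlonglongrightarrow> inner (Y x) y" by (intro tendsto_intros Yx)
    show "(\<lambda>n. inner (?Y n x) y) \<longlonglongrightarrow> inner x (Y y)"
      unfolding iter_sa by (intro tendsto_intros Yx)
  qed
  show ?thesis
  proof
    show "(id_blinfun - Y) ((id_blinfun - Y) x) = x - K x" for x
    proof -
      have "Y x = (1/2) *\<^sub>R (K x + Y (Y x))" for x
        using arg_cong[OF fixpt, of "\<lambda>Z. blinfun_apply Z x"]
        by (simp add: blinfun.add_left blinfun.scaleR_left)
      then have "2 *\<^sub>R Y x = 2 *\<^sub>R ((1/2) *\<^sub>R (K x + Y (Y x)))" by simp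
      then show ?thesis
        by (simp add: blinfun.diff_left blinfun.diff_right scaleR_2 algebra_simps)
    qed
    show "inner ((id_blinfun - Y) x) y = inner x ((id_blinfun - Y) y)" for x y
      by (simp add: blinfun.diff_left inner_diff_left inner_diff_right Ysa)
    show "\<forall>J :: 'a \<Rightarrow>\<^sub>L 'a. (\<forall>x. J (K x) = K (J x)) \<longrightarrow>
        (\<forall>x. J ((id_blinfun - Y) x) = (id_blinfun - Y) (J x))"
    proof (intro allI impI)
      fix J :: "'a \<Rightarrow>\<^sub>L 'a" and x
      assume "\<forall>x. J (K x) = K (J x)"
      then have "J o\<^sub>L K = K o\<^sub>L J" by (simp add: blinfun_eqI)
      then have comm: "J (?Y n x) = ?Y n (J x)" for n
        using commute_sqrt_iter blinfun_apply_blinfun_compose by metis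
      have "(\<lambda>n. J (?Y n x)) \<longlonglongrightarrow> J (Y x)" by (intro tendsto_intros Yx)
      with comm Yx[of "J x"] have "J (Y x) = Y (J x)" using LIMSEQ_unique by fastforce
      then show "J ((id_blinfun - Y) x) = (id_blinfun - Y) (J x)"
        by (simp add: blinfun.diff_left blinfun.diff_right)
    qed
  qed
qed

section \<open>The Friedrichs resolvent\<close>

text \<open>The operator is given by its graph because the application indexes the pairs (y, m) by
  formal combinations; this spares checking that m depends on y alone.\<close>

locale positive_symmetric_relation =
  fixes \<Gamma> :: "('a::{real_inner,banach} \<times> 'a) set"
  assumes subspace: "subspace \<Gamma>"
    and symmetric: "(y, m) \<in> \<Gamma> \<Longrightarrow> (z, k) \<in> \<Gamma> \<Longrightarrow> inner m z = inner y k"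
    and positive: "(y, m) \<in> \<Gamma> \<Longrightarrow> 0 \<le> inner m y"
begin

text \<open>The form norm <(1 + M) y, y>^(1/2), whose completion is the form domain of the
  Friedrichs extension. It takes m as an argument because \<Gamma> is only a relation.\<close>

definition energy :: "'a \<Rightarrow> 'a \<Rightarrow> real" where
  "energy y m = sqrt (inner (y + m) y)"

lemma norm_le_energy: "(y, m) \<in> \<Gamma> \<Longrightarrow> norm y \<le> energy y m"
  unfolding energy_def norm_eq_sqrt_inner
  using positive by (auto simp: inner_add_left)

lemma energy_square: "(y, m) \<in> \<Gamma> \<Longrightarrow> (energy y m)\<^sup>2 = inner (y + m) y"
  unfolding energy_def using positive by (auto simp: inner_add_left)

lemma energy_nonneg: "(y, m) \<in> \<Gamma> \<Longrightarrow> 0 \<le> energy y m"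
  using norm_le_energy norm_ge_zero order_trans by blast

lemma add_mem: "(y, m) \<in> \<Gamma> \<Longrightarrow> (z, k) \<in> \<Gamma> \<Longrightarrow> (y + z, m + k) \<in> \<Gamma>"
  using subspace_add[OF subspace] by fastforce

lemma diff_mem: "(y, m) \<in> \<Gamma> \<Longrightarrow> (z, k) \<in> \<Gamma> \<Longrightarrow> (y - z, m - k) \<in> \<Gamma>"
  using subspace_diff[OF subspace] by fastforce

lemma scaleR_mem: "(y, m) \<in> \<Gamma> \<Longrightarrow> (c *\<^sub>R y, c *\<^sub>R m) \<in> \<Gamma>"
  using subspace_scale[OF subspace] by fastforce

text \<open>\<open>y\<close> solves \<open>y + m = x\<close> up to an error of size \<open>e\<close> in the norm dual to the energy norm. The
  relation \<open>\<Gamma>\<close> need not be closed, so the resolvent is obtained as a limit of such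
  approximate solutions; it belongs to the Friedrichs extension of \<open>\<Gamma>\<close>.\<close>

definition approx :: "real \<Rightarrow> 'a \<Rightarrow> 'a \<Rightarrow> 'a \<Rightarrow> bool" where
  "approx e x y m \<longleftrightarrow>
     (y, m) \<in> \<Gamma> \<and> (\<forall>z k. (z, k) \<in> \<Gamma> \<longrightarrow> \<bar>inner (y + m - x) z\<bar> \<le> e * energy z k)"

lemma approx_exists:
  assumes "0 < e"
  obtains y m where "approx e x y m"
proof -
  \<comment> \<open>Near-minimisers of the convex functional \<open>J\<close> are approximate solutions: apply the discriminant
    criterion to the variation of \<open>J\<close> in the direction \<open>(z, k)\<close>.\<close>
  define J where "J = (\<lambda>(y, m). inner (y + m) y - 2 * inner x y)"
  have "- (norm x)\<^sup>2 \<le> J p" if "p \<in> \<Gamma>" for p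
  proof -
    obtain y m where p: "p = (y, m)" by force
    have "0 \<le> (norm (y - x))\<^sup>2" by simp
    also have "\<dots> \<le> J p + (norm x)\<^sup>2"
      using positive[of y m] that p
      by (simp add: J_def power2_norm_eq_inner inner_diff_left inner_diff_right inner_add_left
          inner_add_right inner_commute[of y m] inner_commute[of y x])
    finally show ?thesis by simp
  qed
  then have bdd: "bdd_below (J ` \<Gamma>)" by (auto intro!: bdd_belowI2)
  have "J ` \<Gamma> \<noteq> {}" using subspace_0[OF subspace] by blast
  \<comment> \<open>The margin is e^2 because t^2 E + 2 t r + e^2 >= 0 for all t gives r^2 <= e^2 E,
    hence the error e in the dual norm.\<close>
  then obtain p where p: "p \<in> \<Gamma>" "J p < Inf (J ` \<Gamma>) + e\<^sup>2"
    using cInf_lessD[of "J ` \<Gamma>" "Inf (J ` \<Gamma>) + e\<^sup>2"] assms by auto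
  obtain y m where ym: "p = (y, m)" by force
  have "\<bar>inner (y + m - x) z\<bar> \<le> e * energy z k" if zk: "(z, k) \<in> \<Gamma>" for z k
  proof -
    define r where "r = inner (y + m - x) z"
    define E where "E = inner (z + k) z"
    have quad: "0 \<le> t\<^sup>2 * E + 2 * t * r + e\<^sup>2" for t
    proof -
      have mem: "(y + t *\<^sub>R z, m + t *\<^sub>R k) \<in> \<Gamma>"
        using add_mem scaleR_mem p ym zk by blast
      have "J (y, m) - e\<^sup>2 \<le> J (y + t *\<^sub>R z, m + t *\<^sub>R k)"
        using cInf_lower[OF imageI[OF mem] bdd] p ym by auto
      also have "\<dots> = J (y, m) + 2 * t * r + t\<^sup>2 * E"
        using symmetric[OF _ zk, of y m] p ym
        by (simp add: J_def r_def E_def inner_add_left inner_add_right inner_diff_left inner_diff_right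
            power2_eq_square algebra_simps inner_commute)
      finally show ?thesis by simp
    qed
    have "E = (energy z k)\<^sup>2" using energy_square[OF zk] by (simp add: E_def)
    moreover have "r\<^sup>2 \<le> e\<^sup>2 * E"
    proof (cases "E = 0")
      case True
      then have "z = 0" using norm_le_energy[OF zk] by (simp add: energy_def E_def)
      then show ?thesis using True by (simp add: r_def)
    next
      case False
      then have "E > 0" using \<open>E = (energy z k)\<^sup>2\<close> by simp
      then show ?thesis using quad[of "- r / E"]
        by (simp add: field_simps power2_eq_square)
    qed
    ultimately have "\<bar>r\<bar> \<le> \<bar>e * energy z k\<bar>"
      by (simp add: power_mult_distrib abs_le_square_iff)
    then show ?thesis using assms energy_nonneg[OF zk] by (simp add: r_def abs_mult)
  qed
  then show ?thesis using that p ym unfolding approx_def by blast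
qed

lemma approx_add:
  assumes "approx e x y m" "approx e' x' y' m'"
  shows "approx (e + e') (x + x') (y + y') (m + m')"
  unfolding approx_def
proof (intro conjI allI impI)
  show "(y + y', m + m') \<in> \<Gamma>" using assms add_mem unfolding approx_def by blast
  fix z k assume "(z, k) \<in> \<Gamma>"
  then have "\<bar>inner (y + m - x) z\<bar> \<le> e * energy z k" "\<bar>inner (y' + m' - x') z\<bar> \<le> e' * energy z k"
    using assms unfolding approx_def by blast+
  then show "\<bar>inner (y + y' + (m + m') - (x + x')) z\<bar> \<le> (e + e') * energy z k"
    by (simp add: inner_add_left inner_diff_left algebra_simps)
qed

lemma approx_scaleR:
  assumes "approx e x y m"
  shows "approx (\<bar>c\<bar> * e) (c *\<^sub>R x) (c *\<^sub>R y) (c *\<^sub>R m)"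
  unfolding approx_def
proof (intro conjI allI impI)
  show "(c *\<^sub>R y, c *\<^sub>R m) \<in> \<Gamma>" using assms scaleR_mem unfolding approx_def by blast
  fix z k assume "(z, k) \<in> \<Gamma>"
  then have "\<bar>inner (y + m - x) z\<bar> \<le> e * energy z k" using assms unfolding approx_def by blast
  then have "\<bar>c\<bar> * \<bar>inner (y + m - x) z\<bar> \<le> \<bar>c\<bar> * (e * energy z k)"
    by (simp add: mult_left_mono)
  then show "\<bar>inner (c *\<^sub>R y + c *\<^sub>R m - c *\<^sub>R x) z\<bar> \<le> \<bar>c\<bar> * e * energy z k"
    by (simp add: algebra_simps flip: scaleR_add_right scaleR_diff_right abs_mult)
qed

text \<open>The difference is an approximate solution for the right-hand side 0. Tested against
  itself it satisfies E^2 <= (e + e') E, and the energy dominates the norm. So approximate solutions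
  converge as the error tends to 0.\<close>

lemma approx_gap:
  assumes "approx e x y m" "approx e' x y' m'" "0 \<le> e" "0 \<le> e'"
  shows "norm (y - y') \<le> e + e'"
proof -
  have mem: "(y - y', m - m') \<in> \<Gamma>" using assms diff_mem unfolding approx_def by blast
  define E where "E = energy (y - y') (m - m')"
  have "approx (e + e') 0 (y - y') (m - m')"
    using approx_add[OF assms(1) approx_scaleR[OF assms(2), of "-1"]] by simp
  then have "\<bar>inner (y - y' + (m - m') - 0) (y - y')\<bar> \<le> (e + e') * E"
    using mem unfolding approx_def E_def by blast
  then have "E\<^sup>2 \<le> (e + e') * E" using energy_square[OF mem] by (simp add: E_def)
  then have "E \<le> e + e' \<or> E = 0"
    using energy_nonneg[OF mem] by (auto simp: E_def power2_eq_square)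
  then show ?thesis using norm_le_energy[OF mem] assms by (auto simp: E_def)
qed

lemma approx_energy_le:
  assumes "approx e x y m" "0 \<le> e"
  shows "energy y m \<le> norm x + e"
proof -
  have mem: "(y, m) \<in> \<Gamma>" using assms unfolding approx_def by blast
  then have "\<bar>inner (y + m - x) y\<bar> \<le> e * energy y m" using assms unfolding approx_def by blast
  then have "(energy y m)\<^sup>2 \<le> inner x y + e * energy y m"
    using energy_square[OF mem] by (simp add: inner_diff_left)
  also have "inner x y \<le> norm x * energy y m"
    using norm_cauchy_schwarz[of x y] norm_le_energy[OF mem]
    by (smt (verit) mult_left_mono norm_ge_zero)
  finally have "energy y m * energy y m \<le> (norm x + e) * energy y m"
    by (simp add: power2_eq_square algebra_simps)
  then show ?thesis using energy_nonneg[OF mem] assms(2)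
    by (cases "energy y m = 0") auto
qed

text \<open>The limit of approximate solutions as e -> 0, pinned down by its rate of approximation
  so that no choice of a sequence enters; existence and uniqueness are part of
  \<open>approx_resolvent\<close>.\<close>

definition resolvent :: "'a \<Rightarrow> 'a" where
  "resolvent x = (THE w. \<forall>e>0. \<forall>y m. approx e x y m \<longrightarrow> norm (y - w) \<le> e)"

lemma approx_resolvent:
  assumes "approx e x y m" "0 < e"
  shows "norm (y - resolvent x) \<le> e"
proof -
  have "\<exists>p. approx (inverse (real (Suc n))) x (fst p) (snd p)" for n
    by (rule approx_exists[of "inverse (real (Suc n))" x]) auto
  then obtain p where p: "\<And>n. approx (inverse (real (Suc n))) x (fst (p n)) (snd (p n))"
    by metis
  define Y where "Y n = fst (p n)" for n
  have gap: "norm (y - Y n) \<le> e + inverse (real (Suc n))" if "approx e x y m" "0 < e" for e y m n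
    unfolding Y_def using approx_gap[OF that(1) p] that(2) by simp
  have "Cauchy Y"
  proof (rule CauchyI)
    fix r :: real assume "0 < r"
    then obtain M where M: "inverse (real (Suc M)) < r / 2" using reals_Archimedean half_gt_zero by blast
    have "norm (Y i - Y j) < r" if "M \<le> i" "M \<le> j" for i j
    proof -
      have "inverse (real (Suc k)) < r / 2" if "M \<le> k" for k
      proof -
        have "inverse (real (Suc k)) \<le> inverse (real (Suc M))"
          using that by (intro le_imp_inverse_le) auto
        then show ?thesis using M by linarith
      qed
      from this[OF \<open>M \<le> i\<close>] this[OF \<open>M \<le> j\<close>] show ?thesis using gap[OF p, of i j] by (simp add: Y_def)
    qed
    then show "\<exists>M. \<forall>m\<ge>M. \<forall>n\<ge>M. norm (Y m - Y n) < r" by blast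
  qed
  then obtain w where w: "Y \<longlonglongrightarrow> w" using Cauchy_convergent_iff convergent_def by blast
  have lim: "norm (y - w) \<le> e" if "approx e x y m" "0 < e" for e y m
  proof (rule LIMSEQ_le)
    show "(\<lambda>n. norm (y - Y n)) \<longlonglongrightarrow> norm (y - w)" by (intro tendsto_intros w)
    show "(\<lambda>n. e + inverse (real (Suc n))) \<longlonglongrightarrow> e"
      using tendsto_add[OF tendsto_const LIMSEQ_inverse_real_of_nat, of e] by simp
    show "\<exists>N. \<forall>n\<ge>N. norm (y - Y n) \<le> e + inverse (real (Suc n))" using gap[OF that] by blast
  qed
  have "v = w" if v: "\<forall>e>0. \<forall>y m. approx e x y m \<longrightarrow> norm (y - v) \<le> e" for v
  proof -
    have "norm (v - w) \<le> 0 + r" if "0 < r" for r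
    proof -
      have "0 < r / 2" using that by simp
      then obtain y m where ym: "approx (r / 2) x y m" using approx_exists by blast
      then have "norm (y - v) \<le> r / 2" "norm (y - w) \<le> r / 2" using v lim \<open>0 < r / 2\<close> by blast+
      then show ?thesis using norm_triangle_ineq4[of "y - w" "y - v"] by simp
    qed
    then have "norm (v - w) \<le> 0" by (rule field_le_epsilon)
    then show ?thesis by simp
  qed
  then have "resolvent x = w" unfolding resolvent_def
    by (intro the_equality) (use lim in auto)
  then show ?thesis using lim assms by blast
qed

text \<open>The tool for identifying values: approximate solutions near the candidate suffice, at
  any linear rate c. Algebraic laws use c = 1, an exact solution uses c = 0.\<close>

lemma resolvent_eqI:
  assumes "\<And>e. 0 < e \<Longrightarrow> \<exists>y m. approx e x y m \<and> norm (y - w) \<le> c * e" "0 \<le> c"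
  shows "resolvent x = w"
proof -
  have "norm (resolvent x - w) \<le> 0 + r" if "0 < r" for r
  proof -
    define e where "e = r / (1 + c)"
    have e: "0 < e" using that assms(2) by (simp add: e_def)
    then obtain y m where "approx e x y m" "norm (y - w) \<le> c * e" using assms by blast
    then have "norm (resolvent x - w) \<le> (1 + c) * e"
      using approx_resolvent[OF _ e, of x y m] norm_triangle_ineq4[of "y - w" "y - resolvent x"]
      by (simp add: algebra_simps)
    then show ?thesis using assms(2) by (simp add: e_def)
  qed
  then have "norm (resolvent x - w) \<le> 0" by (rule field_le_epsilon)
  then show ?thesis by simp
qed

lemma approx_mono: "approx e x y m \<Longrightarrow> e \<le> e' \<Longrightarrow> approx e' x y m"
  unfolding approx_def by (meson energy_nonneg mult_right_mono order_trans)

lemma resolvent_add: "resolvent (x + x') = resolvent x + resolvent x'"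
proof (rule resolvent_eqI[where c = 1])
  fix e :: real assume "0 < e"
  then obtain y m y' m' where a: "approx (e / 2) x y m" "approx (e / 2) x' y' m'"
    using approx_exists half_gt_zero by metis
  then have "approx e (x + x') (y + y') (m + m')" using approx_add by fastforce
  moreover have "norm (y + y' - (resolvent x + resolvent x')) \<le> 1 * e"
    using approx_resolvent[OF a(1)] approx_resolvent[OF a(2)] \<open>0 < e\<close>
      norm_triangle_ineq[of "y - resolvent x" "y' - resolvent x'"]
    by (simp add: algebra_simps)
  ultimately show "\<exists>y m. approx e (x + x') y m \<and> norm (y - (resolvent x + resolvent x')) \<le> 1 * e"
    by blast
qed simp

lemma resolvent_scaleR: "resolvent (c *\<^sub>R x) = c *\<^sub>R resolvent x"
proof (rule resolvent_eqI[where c = 1])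
  fix e :: real assume "0 < e"
  define d where "d = e / (\<bar>c\<bar> + 1)"
  have d: "0 < d" using \<open>0 < e\<close> by (simp add: d_def)
  have cd: "\<bar>c\<bar> * d \<le> e" using \<open>0 < e\<close> by (simp add: d_def field_simps)
  obtain y m where a: "approx d x y m" using approx_exists[OF d] by blast
  have "approx e (c *\<^sub>R x) (c *\<^sub>R y) (c *\<^sub>R m)"
    using approx_scaleR[OF a] approx_mono cd by blast
  moreover have "norm (c *\<^sub>R y - c *\<^sub>R resolvent x) \<le> 1 * e"
    using mult_left_mono[OF approx_resolvent[OF a d], of "\<bar>c\<bar>"] cd
    by (simp flip: scaleR_diff_right)
  ultimately show "\<exists>y m. approx e (c *\<^sub>R x) y m \<and> norm (y - c *\<^sub>R resolvent x) \<le> 1 * e"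
    by blast
qed simp

lemma resolvent_graph:
  assumes "(y, m) \<in> \<Gamma>"
  shows "resolvent (y + m) = y"
proof (rule resolvent_eqI[where c = 0])
  fix e :: real assume "0 < e"
  then have "approx e (y + m) y m"
    using assms energy_nonneg unfolding approx_def by simp
  then show "\<exists>y' m'. approx e (y + m) y' m' \<and> norm (y' - y) \<le> 0 * e"
    by (intro exI[of _ y] exI[of _ m]) simp
qed simp

text \<open>With y = C x this is |y|^2 <= <(1 + M) y, y>, obtained in the limit of approximate
  solutions. As an operator inequality it says C^2 <= C, from which both 0 <= C <= 1 and the norm
  bounds on C and 1 - C follow.\<close>

lemma norm_resolvent_square_le: "(norm (resolvent x))\<^sup>2 \<le> inner x (resolvent x)"
proof -
  \<comment> \<open>The upper bound on e keeps the left-hand base nonnegative, so that squaring is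
    monotone. It costs nothing: e tends to 0, and \<open>resolvent x = 0\<close> is treated
    apart.\<close>
  have "(norm (resolvent x) - e)\<^sup>2 \<le> inner x (resolvent x) + norm x * e + e * (norm x + e)"
    if "0 < e" "e \<le> norm (resolvent x)" for e
  proof -
    obtain y m where a: "approx e x y m" using approx_exists[OF \<open>0 < e\<close>] by blast
    then have mem: "(y, m) \<in> \<Gamma>" unfolding approx_def by blast
    have d: "norm (y - resolvent x) \<le> e" using approx_resolvent[OF a that(1)] .
    have "norm (resolvent x) - e \<le> norm y"
      using d norm_triangle_ineq2[of "resolvent x" y] by (simp add: norm_minus_commute)
    then have "norm (resolvent x) - e \<le> energy y m" using norm_le_energy[OF mem] by linarith
    then have 1: "(norm (resolvent x) - e)\<^sup>2 \<le> (energy y m)\<^sup>2"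
      using that by (intro power_mono) auto
    have "\<bar>inner (y + m - x) y\<bar> \<le> e * energy y m" using a mem unfolding approx_def by blast
    then have 2: "(energy y m)\<^sup>2 \<le> inner x y + e * energy y m"
      using energy_square[OF mem] by (simp add: inner_diff_left)
    have "e * energy y m \<le> e * (norm x + e)"
      using approx_energy_le[OF a] that by simp
    moreover have "inner x y \<le> inner x (resolvent x) + norm x * e"
      using norm_cauchy_schwarz[of x "y - resolvent x"] mult_left_mono[OF d, of "norm x"]
      by (simp add: inner_diff_right)
    ultimately show ?thesis using 1 2 by linarith
  qed
  note bound = this
  show ?thesis
  proof (cases "resolvent x = 0")
    case False
    have l: "((\<lambda>e. (norm (resolvent x) - e)\<^sup>2) \<longlongrightarrow> (norm (resolvent x) - 0)\<^sup>2) (at_right 0)"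
      by (intro tendsto_intros)
    have r: "((\<lambda>e. inner x (resolvent x) + norm x * e + e * (norm x + e)) \<longlongrightarrow>
        inner x (resolvent x) + norm x * 0 + 0 * (norm x + 0)) (at_right 0)"
      by (intro tendsto_intros)
    have "eventually (\<lambda>e. e \<in> {0<..<norm (resolvent x)}) (at_right 0)"
      using False by (intro eventually_at_right_real) simp
    then have ev: "eventually (\<lambda>e. (norm (resolvent x) - e)\<^sup>2
        \<le> inner x (resolvent x) + norm x * e + e * (norm x + e)) (at_right 0)"
      by (rule eventually_mono) (use bound in auto)
    show ?thesis using tendsto_le[OF trivial_limit_at_right_real r l ev] by simp
  next
    case True
    then show ?thesis by simp
  qed
qed

lemma bounded_linear_resolvent: "bounded_linear resolvent"
proof (rule bounded_linear_intro)
  fix x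
  have "norm (resolvent x) * norm (resolvent x) \<le> norm x * norm (resolvent x)"
    using norm_resolvent_square_le[of x] norm_cauchy_schwarz[of x "resolvent x"]
    by (simp add: power2_eq_square)
  then show "norm (resolvent x) \<le> norm x * 1"
    by (cases "resolvent x = 0") auto
qed (simp_all add: resolvent_add resolvent_scaleR)

text \<open>Test the approximate equation for x with the solution for x' and conversely; symmetry of
  \<Gamma> cancels the main terms and leaves errors of order e.\<close>

lemma inner_resolvent: "inner (resolvent x) x' = inner x (resolvent x')"
proof -
  have "\<bar>inner (resolvent x) x' - inner x (resolvent x')\<bar> \<le> 0 + r" if "0 < r" for r
  proof -
    \<comment> \<open>Since e <= 1, B dominates the sum of the two energies, and also norm x + norm
      x'. The total error is then at most 2 e B, which explains the choice of e.\<close>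
    define B where "B = 2 * (norm x + norm x' + 1)"
    have B: "0 < B" by (simp add: B_def add_nonneg_pos)
    define e where "e = min 1 (r / (B * 2))"
    have e: "0 < e" "e \<le> 1" "e * B * 2 \<le> r" using that B by (auto simp: e_def min_def field_simps)
    obtain y m where a: "approx e x y m" using approx_exists[OF e(1)] by blast
    obtain y' m' where a': "approx e x' y' m'" using approx_exists[OF e(1)] by blast
    have mem: "(y, m) \<in> \<Gamma>" "(y', m') \<in> \<Gamma>" using a a' unfolding approx_def by blast+
    have "\<bar>inner (y + m - x) y'\<bar> \<le> e * energy y' m'" "\<bar>inner (y' + m' - x') y\<bar> \<le> e * energy y m"
      using a a' mem unfolding approx_def by blast+
    moreover have "energy y m \<le> norm x + 1" "energy y' m' \<le> norm x' + 1"
      using approx_energy_le[OF a] approx_energy_le[OF a'] e by auto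
    then have "energy y m + energy y' m' \<le> B"
      using norm_ge_zero[of x] norm_ge_zero[of x'] unfolding B_def by argo
    then have "e * energy y m + e * energy y' m' \<le> e * B"
      using e(1) mult_left_mono[of "energy y m + energy y' m'" B e] by (simp add: distrib_left) 
    moreover have "inner (y + m) y' = inner (y' + m') y"
      using symmetric[OF mem] by (simp add: inner_add_left inner_commute[of y y'] inner_commute[of y m'])
    ultimately have 1: "\<bar>inner x y' - inner x' y\<bar> \<le> e * B"
      by (simp add: inner_diff_left)
    have "\<bar>inner x (y' - resolvent x')\<bar> \<le> norm x * e" "\<bar>inner x' (y - resolvent x)\<bar> \<le> norm x' * e"
      using approx_resolvent[OF a e(1)] approx_resolvent[OF a' e(1)]
      by (meson Cauchy_Schwarz_ineq2 mult_left_mono norm_ge_zero order_trans)+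
    moreover have "norm x * e + norm x' * e \<le> e * B"
    proof -
      have "norm x + norm x' \<le> B" using norm_ge_zero[of x] norm_ge_zero[of x'] unfolding B_def by argo
      then show ?thesis using e(1) mult_left_mono[of "norm x + norm x'" B e] by (simp add: algebra_simps)
    qed
    ultimately have "\<bar>inner (resolvent x) x' - inner x (resolvent x')\<bar> \<le> e * B * 2"
      using 1 by (simp add: inner_diff_right inner_commute[of "resolvent x" x'])
    then show ?thesis using e by simp
  qed
  then have "\<bar>inner (resolvent x) x' - inner x (resolvent x')\<bar> \<le> 0" by (rule field_le_epsilon)
  then show ?thesis by simp
qed

text \<open>An isometric bijection preserving \<Gamma> in both directions preserves the energy, so
  it carries approximate solutions for x to approximate solutions for J x. The inverse J', which is
  also the adjoint, pulls the test elements back.\<close>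

lemma resolvent_commute:
  assumes J: "linear J" "\<And>a b. inner (J a) b = inner a (J' b)" "\<And>b. J (J' b) = b" "\<And>a. J' (J a) = a"
    and mem: "\<And>y m. (y, m) \<in> \<Gamma> \<Longrightarrow> (J y, J m) \<in> \<Gamma>"
    and mem': "\<And>y m. (y, m) \<in> \<Gamma> \<Longrightarrow> (J' y, J' m) \<in> \<Gamma>"
  shows "resolvent (J x) = J (resolvent x)"
proof (rule resolvent_eqI[where c = 1])
  have iso: "norm (J a) = norm a" for a by (simp add: norm_eq_sqrt_inner J)
  have "inner (J' a) (J' b) = inner a b" for a b by (metis J(2,3))
  then have en: "energy (J' z) (J' k) = energy z k" for z k
    by (simp add: energy_def inner_add_left)
  fix e :: real assume "0 < e"
  then obtain y m where a: "approx e x y m" using approx_exists by blast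
  have "\<bar>inner (J y + J m - J x) z\<bar> \<le> e * energy z k" if "(z, k) \<in> \<Gamma>" for z k
  proof -
    have "inner (J y + J m - J x) z = inner (y + m - x) (J' z)"
      by (simp add: J(2) flip: linear_add[OF J(1)] linear_diff[OF J(1)])
    then show ?thesis using a mem'[OF that] unfolding approx_def by (metis en)
  qed
  then have "approx e (J x) (J y) (J m)" using mem a unfolding approx_def by blast
  moreover have "norm (J y - J (resolvent x)) \<le> 1 * e"
    using approx_resolvent[OF a \<open>0 < e\<close>] iso by (simp flip: linear_diff[OF J(1)])
  ultimately show "\<exists>y m. approx e (J x) y m \<and> norm (y - J (resolvent x)) \<le> 1 * e" by blast
qed simp

end

section \<open>The Hilbert space of square-summable functions\<close>

text \<open>A type for the carrier of \<open>ell2\<close>: bounded linear maps and completeness are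
  type-class notions, while \<open>ell2\<close> is a record on a set. It gets a real and a complex
  inner product inducing the same norm.\<close>

typedef 'g l2 = "{f :: 'g \<Rightarrow> complex. (\<lambda>x. (cmod (f x))\<^sup>2) summable_on UNIV}"
  morphisms l2_apply Abs_l2 by (rule exI[of _ "\<lambda>_. 0"]) simp

setup_lifting type_definition_l2

lemma square_summable_add:
  assumes "(\<lambda>x. (cmod (f x))\<^sup>2) summable_on A" "(\<lambda>x. (cmod (g x))\<^sup>2) summable_on A"
  shows "(\<lambda>x. (cmod (f x + g x))\<^sup>2) summable_on A"
proof (rule summable_on_comparison_test)
  show "(\<lambda>x. 2 * (cmod (f x))\<^sup>2 + 2 * (cmod (g x))\<^sup>2) summable_on A"
    by (intro summable_on_add summable_on_cmult_right assms)
  fix x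
  have "(cmod (f x + g x))\<^sup>2 \<le> (cmod (f x) + cmod (g x))\<^sup>2"
    by (intro power_mono norm_triangle_ineq) simp
  also have "\<dots> \<le> 2 * (cmod (f x))\<^sup>2 + 2 * (cmod (g x))\<^sup>2"
    using zero_le_power2[of "cmod (f x) - cmod (g x)"] by (simp add: power2_eq_square algebra_simps)
  finally show "(cmod (f x + g x))\<^sup>2 \<le> 2 * (cmod (f x))\<^sup>2 + 2 * (cmod (g x))\<^sup>2" .
qed simp

lemma square_summable_mult:
  assumes "(\<lambda>x. (cmod (f x))\<^sup>2) summable_on A" "(\<lambda>x. (cmod (g x))\<^sup>2) summable_on A"
  shows "(\<lambda>x. f x * cnj (g x)) summable_on A"
proof (rule abs_summable_summable, rule Infinite_Sum.abs_summable_on_comparison_test')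
  show "(\<lambda>x. (cmod (f x))\<^sup>2 + (cmod (g x))\<^sup>2) summable_on A"
    by (intro summable_on_add assms)
  show "norm (f x * cnj (g x)) \<le> (cmod (f x))\<^sup>2 + (cmod (g x))\<^sup>2" for x
  proof -
    have "0 \<le> (cmod (f x) - cmod (g x))\<^sup>2" "0 \<le> cmod (f x) * cmod (g x)" by simp_all
    then have "cmod (f x) * cmod (g x) \<le> (cmod (f x))\<^sup>2 + (cmod (g x))\<^sup>2"
      unfolding power2_diff by linarith
    then show ?thesis by (simp add: norm_mult)
  qed
qed

lemma square_summable_cmult:
  assumes "(\<lambda>x. (cmod (f x))\<^sup>2) summable_on A"
  shows "(\<lambda>x. (cmod (c * f x))\<^sup>2) summable_on A"
  by (simp add: norm_mult power_mult_distrib summable_on_cmult_right assms)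

lemma l2_apply_summable: "(\<lambda>x. (cmod (l2_apply a x))\<^sup>2) summable_on UNIV"
  using l2_apply by blast

instantiation l2 :: (type) real_inner
begin

lift_definition zero_l2 :: "'a l2" is "\<lambda>_. 0" by simp
lift_definition plus_l2 :: "'a l2 \<Rightarrow> 'a l2 \<Rightarrow> 'a l2" is "\<lambda>f g x. f x + g x"
  by (rule square_summable_add)
lift_definition uminus_l2 :: "'a l2 \<Rightarrow> 'a l2" is "\<lambda>f x. - f x" by simp
lift_definition minus_l2 :: "'a l2 \<Rightarrow> 'a l2 \<Rightarrow> 'a l2" is "\<lambda>f g x. f x - g x"
  using square_summable_add[of _ UNIV "\<lambda>x. - _ x"] by simp
lift_definition scaleR_l2 :: "real \<Rightarrow> 'a l2 \<Rightarrow> 'a l2" is "\<lambda>r f x. complex_of_real r * f x"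
  by (rule square_summable_cmult)
lift_definition inner_l2 :: "'a l2 \<Rightarrow> 'a l2 \<Rightarrow> real" is "\<lambda>f g. Re (\<Sum>\<^sub>\<infinity>x. f x * cnj (g x))" .
definition norm_l2 :: "'a l2 \<Rightarrow> real" where "norm_l2 a = sqrt (inner a a)"
definition dist_l2 :: "'a l2 \<Rightarrow> 'a l2 \<Rightarrow> real" where "dist_l2 a b = norm (a - b)"
definition sgn_l2 :: "'a l2 \<Rightarrow> 'a l2" where "sgn_l2 a = inverse (norm a) *\<^sub>R a"
definition uniformity_l2 :: "('a l2 \<times> 'a l2) filter" where
  "uniformity_l2 = (INF e\<in>{0<..}. principal {(x, y). dist x y < e})"
definition open_l2 :: "'a l2 set \<Rightarrow> bool" where
  "open_l2 U \<longleftrightarrow> (\<forall>x\<in>U. eventually (\<lambda>(x', y). x' = x \<longrightarrow> y \<in> U) uniformity)"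

lemma l2_inner_self: "inner (a :: 'a l2) a = (\<Sum>\<^sub>\<infinity>x. (cmod (l2_apply a x))\<^sup>2)"
proof -
  have "(\<Sum>\<^sub>\<infinity>x. l2_apply a x * cnj (l2_apply a x)) = of_real (\<Sum>\<^sub>\<infinity>x. (cmod (l2_apply a x))\<^sup>2)"
    using infsumI[OF has_sum_of_real[where 'a = complex, OF has_sum_infsum[OF l2_apply_summable[of a]]]]
    by (simp add: complex_norm_square del: of_real_power)
  then show ?thesis by (simp add: inner_l2.rep_eq)
qed

instance
proof
  fix a b c :: "'a l2" and r s :: real
  show "a + b + c = a + (b + c)" "a + b = b + a" "0 + a = a" "- a + a = 0" "a - b = a + - b"
    "r *\<^sub>R (a + b) = r *\<^sub>R a + r *\<^sub>R b" "(r + s) *\<^sub>R a = r *\<^sub>R a + s *\<^sub>R a"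
    "r *\<^sub>R s *\<^sub>R a = (r * s) *\<^sub>R a" "1 *\<^sub>R a = a"
    by (transfer; simp add: fun_eq_iff algebra_simps)+
  show "dist a b = norm (a - b)" "sgn a = inverse (norm a) *\<^sub>R a" "norm a = sqrt (inner a a)"
    "uniformity = (INF e\<in>{0<..}. principal {(x, y :: 'a l2). dist x y < e})"
    by (simp_all only: dist_l2_def sgn_l2_def norm_l2_def uniformity_l2_def)
  show "open U \<longleftrightarrow> (\<forall>x\<in>U. eventually (\<lambda>(x', y). x' = x \<longrightarrow> y \<in> U) uniformity)" for U :: "'a l2 set"
    by (simp only: open_l2_def)
  have "(\<Sum>\<^sub>\<infinity>x. l2_apply a x * cnj (l2_apply b x)) = cnj (\<Sum>\<^sub>\<infinity>x. l2_apply b x * cnj (l2_apply a x))"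
    by (simp add: mult.commute flip: infsum_cnj)
  then show "inner a b = inner b a" by (simp add: inner_l2.rep_eq)
  show "inner (a + b) c = inner a c + inner b c"
    by (simp add: inner_l2.rep_eq plus_l2.rep_eq distrib_right infsum_add square_summable_mult
        l2_apply_summable)
  show "inner (r *\<^sub>R a) b = r * inner a b"
    by (simp add: inner_l2.rep_eq scaleR_l2.rep_eq mult.assoc infsum_cmult_right')
  show "0 \<le> inner a a" by (simp add: l2_inner_self infsum_nonneg)
  show "inner a a = 0 \<longleftrightarrow> a = 0"
  proof
    assume "inner a a = 0"
    then have "(cmod (l2_apply a x))\<^sup>2 = 0" for x
      using nonneg_infsum_le_0D[of "\<lambda>x. (cmod (l2_apply a x))\<^sup>2" UNIV x]
      by (simp add: l2_inner_self l2_apply_summable)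
    then show "a = 0" by transfer (simp add: fun_eq_iff)
  qed (simp add: l2_inner_self zero_l2.rep_eq)
qed

end

instantiation l2 :: (type) complex_inner
begin

lift_definition scaleC_l2 :: "complex \<Rightarrow> 'a l2 \<Rightarrow> 'a l2" is "\<lambda>c f x. c * f x"
  by (rule square_summable_cmult)
lift_definition cinner_l2 :: "'a l2 \<Rightarrow> 'a l2 \<Rightarrow> complex" is "\<lambda>f g. \<Sum>\<^sub>\<infinity>x. f x * cnj (g x)" .

instance
proof
  fix a b c :: "'a l2" and r s :: complex and t :: real
  show "r *\<^sub>C (a + b) = r *\<^sub>C a + r *\<^sub>C b" "(r + s) *\<^sub>C a = r *\<^sub>C a + s *\<^sub>C a"
    "r *\<^sub>C s *\<^sub>C a = (r * s) *\<^sub>C a" "t *\<^sub>R a = complex_of_real t *\<^sub>C a"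
    by (transfer; simp add: fun_eq_iff algebra_simps)+
  show "cinner a b = cnj (cinner b a)"
    by (simp add: cinner_l2.rep_eq mult.commute flip: infsum_cnj)
  show "cinner (a + b) c = cinner a c + cinner b c"
    by (simp add: cinner_l2.rep_eq plus_l2.rep_eq distrib_right infsum_add square_summable_mult
        l2_apply_summable)
  show "cinner (r *\<^sub>C a) b = r * cinner a b"
    by (simp add: cinner_l2.rep_eq scaleC_l2.rep_eq mult.assoc infsum_cmult_right')
  show "norm a = sqrt (Re (cinner a a))"
    by (simp add: norm_l2_def inner_l2.rep_eq cinner_l2.rep_eq)
qed

end

lemma inner_l2_eq_Re_cinner: "inner (a :: 'g l2) b = Re (cinner a b)"
  by (simp add: inner_l2.rep_eq cinner_l2.rep_eq)

lemma l2_norm_square: "(norm (a :: 'g l2))\<^sup>2 = (\<Sum>\<^sub>\<infinity>x. (cmod (l2_apply a x))\<^sup>2)"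
  by (simp add: power2_norm_eq_inner l2_inner_self)

lemma sum_le_l2_norm_square: "finite K \<Longrightarrow> (\<Sum>x\<in>K. (cmod (l2_apply a x))\<^sup>2) \<le> (norm a)\<^sup>2"
  unfolding l2_norm_square by (intro finite_sum_le_infsum l2_apply_summable) auto

text \<open>The candidate f is the coordinatewise limit. A bound on \<open>X m - X n\<close> summed
  over a finite set survives n -> \<infinity> with a constant independent of the set; this one
  estimate gives both square-summability of f and convergence in norm.\<close>

instance l2 :: (type) banach
proof
  fix X :: "nat \<Rightarrow> 'a l2" assume X: "Cauchy X"
  have coord: "cmod (l2_apply a x) \<le> norm a" for a :: "'a l2" and x
    by (rule power2_le_imp_le) (use sum_le_l2_norm_square[of "{x}" a] in simp_all)
  have "Cauchy (\<lambda>n. l2_apply (X n) x)" for x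
  proof (rule CauchyI)
    fix e :: real assume "0 < e"
    then obtain M where "\<forall>m\<ge>M. \<forall>n\<ge>M. norm (X m - X n) < e" using X CauchyD by blast
    moreover have "norm (l2_apply (X m) x - l2_apply (X n) x) \<le> norm (X m - X n)" for m n
      using coord[of "X m - X n" x] by (simp add: minus_l2.rep_eq)
    ultimately show "\<exists>M. \<forall>m\<ge>M. \<forall>n\<ge>M. norm (l2_apply (X m) x - l2_apply (X n) x) < e"
      by (meson order_le_less_trans)
  qed
  then obtain f where f: "\<And>x. (\<lambda>n. l2_apply (X n) x) \<longlonglongrightarrow> f x"
    unfolding Cauchy_convergent_iff convergent_def by metis
  have bound: "(\<Sum>x\<in>K. (cmod (l2_apply (X m) x - f x))\<^sup>2) \<le> e\<^sup>2"
    if "\<forall>n\<ge>M. norm (X m - X n) < e" "finite K" for M m e K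
  proof (rule LIMSEQ_le_const2)
    show "(\<lambda>n. \<Sum>x\<in>K. (cmod (l2_apply (X m) x - l2_apply (X n) x))\<^sup>2)
        \<longlonglongrightarrow> (\<Sum>x\<in>K. (cmod (l2_apply (X m) x - f x))\<^sup>2)"
      by (intro tendsto_intros f)
    have "(\<Sum>x\<in>K. (cmod (l2_apply (X m) x - l2_apply (X n) x))\<^sup>2) \<le> e\<^sup>2" if "n \<ge> M" for n
    proof -
      have "(\<Sum>x\<in>K. (cmod (l2_apply (X m) x - l2_apply (X n) x))\<^sup>2) \<le> (norm (X m - X n))\<^sup>2"
        using sum_le_l2_norm_square[OF \<open>finite K\<close>, of "X m - X n"] by (simp add: minus_l2.rep_eq)
      also have "\<dots> \<le> e\<^sup>2"
        using \<open>\<forall>n\<ge>M. norm (X m - X n) < e\<close> that by (intro power_mono) (auto intro: less_imp_le)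
      finally show ?thesis .
    qed
    then show "\<exists>N. \<forall>n\<ge>N. (\<Sum>x\<in>K. (cmod (l2_apply (X m) x - l2_apply (X n) x))\<^sup>2) \<le> e\<^sup>2" by blast
  qed
  have summ: "(\<lambda>x. (cmod (l2_apply (X m) x - f x))\<^sup>2) summable_on UNIV"
    if "\<forall>n\<ge>M. norm (X m - X n) < e" for M m e
    by (intro nonneg_bdd_above_summable_on bdd_aboveI2[of _ _ "e\<^sup>2"]) (use bound[OF that] in simp_all)
  obtain M where M: "\<forall>m\<ge>M. \<forall>n\<ge>M. norm (X m - X n) < 1" using X CauchyD zero_less_one by blast
  have "(\<lambda>x. (cmod (f x))\<^sup>2) summable_on UNIV"
  proof -
    have "(\<lambda>x. (cmod (f x - l2_apply (X M) x))\<^sup>2) summable_on UNIV"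
      using summ[of M M 1] M by (simp add: norm_minus_commute)
    then show ?thesis
      using square_summable_add[OF _ l2_apply_summable[of "X M"], of "\<lambda>x. f x - l2_apply (X M) x"] by simp
  qed
  then obtain a where a: "l2_apply a = f" using Abs_l2_inverse[of f] by auto
  have "X \<longlonglongrightarrow> a"
  proof (rule LIMSEQ_I)
    fix e :: real assume "0 < e"
    then obtain M where M: "\<forall>m\<ge>M. \<forall>n\<ge>M. norm (X m - X n) < e / 2"
      using CauchyD[OF X, of "e / 2"] by auto
    have "norm (X m - a) < e" if mM: "m \<ge> M" for m
    proof -
      have *: "\<forall>n\<ge>M. norm (X m - X n) < e / 2" using M mM by blast
      have "(norm (X m - a))\<^sup>2 \<le> (e / 2)\<^sup>2"
        unfolding l2_norm_square minus_l2.rep_eq a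
        by (rule infsum_le_finite_sums[OF summ[OF *] bound[OF *]])
      then have "norm (X m - a) \<le> e / 2" by (rule power2_le_imp_le) (use \<open>0 < e\<close> in simp)
      then show ?thesis using \<open>0 < e\<close> by simp
    qed
    then show "\<exists>M. \<forall>n\<ge>M. norm (X n - a) < e" by blast
  qed
  then show "convergent X" by (auto simp: convergent_def)
qed

section \<open>Inner products and linear combinations\<close>

lemma cinner_add_right: "cinner x (y + z) = cinner x y + cinner x z"
  by (metis cinner_add_left cinner_commute complex_cnj_add)

lemma cinner_scaleC_right: "cinner x (c *\<^sub>C y) = cnj c * cinner x y"
  by (metis cinner_scaleC_left cinner_commute complex_cnj_mult)

lemma scaleC_zero_right [simp]: "c *\<^sub>C (0 :: 'a::complex_inner) = 0"
  using scaleC_add_right[of c 0 "0 :: 'a"] by simp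

lemma scaleC_minus_one [simp]: "(- 1) *\<^sub>C x = - x"
  using scaleR_scaleC[of "- 1" x] by simp

lemma scaleC_diff_right: "c *\<^sub>C (x - y) = c *\<^sub>C x - c *\<^sub>C y"
  by (metis add_diff_cancel diff_add_cancel scaleC_add_right)

lemma cinner_zero_left [simp]: "cinner 0 y = 0"
  using cinner_add_left[of 0 0 y] by simp

lemma cinner_zero_right [simp]: "cinner x 0 = 0"
  using cinner_add_right[of x 0 0] by simp

lemma cinner_self: "cinner x x = complex_of_real ((norm x)\<^sup>2)"
proof -
  have "Im (cinner x x) = 0" using cinner_commute[of x x] by (metis cnj.sel(2) equal_neg_zero)
  \<comment> \<open>\<open>sqrt\<close> is negative on negative reals, so nonnegativity of the norm
    forces the real part to be nonnegative.\<close>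
  moreover have "0 \<le> Re (cinner x x)"
    using norm_eq_sqrt_cinner[of x] norm_ge_zero[of x] by simp
  then have "Re (cinner x x) = (norm x)\<^sup>2" by (simp add: norm_eq_sqrt_cinner)
  ultimately show ?thesis by (simp add: complex_eq_iff)
qed

lemma norm_scaleC: "norm (c *\<^sub>C x) = cmod c * norm x"
proof -
  have "complex_of_real ((norm (c *\<^sub>C x))\<^sup>2) = c * cnj c * cinner x x"
    unfolding cinner_self[symmetric] cinner_scaleC_left cinner_scaleC_right by simp
  also have "\<dots> = complex_of_real ((cmod c * norm x)\<^sup>2)"
    unfolding cinner_self using complex_norm_square[of c] by (simp add: power_mult_distrib)
  finally have "(norm (c *\<^sub>C x))\<^sup>2 = (cmod c * norm x)\<^sup>2" using of_real_eq_iff by blast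
  then show ?thesis by (rule power2_eq_imp_eq) simp_all
qed

lemma polarization:
  "4 * cinner x y = complex_of_real ((norm (x + y))\<^sup>2) - complex_of_real ((norm (x + (- 1) *\<^sub>C y))\<^sup>2)
     + \<i> * complex_of_real ((norm (x + \<i> *\<^sub>C y))\<^sup>2) - \<i> * complex_of_real ((norm (x + (- \<i>) *\<^sub>C y))\<^sup>2)"
  unfolding cinner_self[symmetric] cinner_add_left cinner_add_right cinner_scaleC_left cinner_scaleC_right
  by (simp add: algebra_simps)

text \<open>A crude substitute for Cauchy-Schwarz from polarization and the triangle inequality; it
  serves to show that correlations of a bounded function are bounded.\<close>

lemma cmod_cinner_le: "cmod (cinner x y) \<le> (norm x + norm y)\<^sup>2"
proof -
  have le: "(norm (x + c *\<^sub>C y))\<^sup>2 \<le> (norm x + norm y)\<^sup>2" if "cmod c = 1" for c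
    using norm_triangle_ineq[of x "c *\<^sub>C y"] that by (intro power_mono) (simp_all add: norm_scaleC)
  have "4 * cmod (cinner x y) = cmod (4 * cinner x y)" by (simp add: norm_mult)
  also have "\<dots> \<le> (norm (x + 1 *\<^sub>C y))\<^sup>2 + (norm (x + (- 1) *\<^sub>C y))\<^sup>2
      + (norm (x + \<i> *\<^sub>C y))\<^sup>2 + (norm (x + (- \<i>) *\<^sub>C y))\<^sup>2"
  proof -
    have tri: "cmod (complex_of_real a - complex_of_real b + \<i> * complex_of_real c - \<i> * complex_of_real d)
        \<le> a + b + c + d" if "0 \<le> a" "0 \<le> b" "0 \<le> c" "0 \<le> d" for a b c d
      by (rule order_trans[OF norm_triangle_ineq4] order_trans[OF add_mono[OF norm_triangle_ineq order_refl]]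
          order_trans[OF add_mono[OF add_mono[OF norm_triangle_ineq4 order_refl] order_refl]])+
        (use that in \<open>simp add: norm_mult\<close>)
    show ?thesis unfolding polarization scaleC_one by (rule tri) simp_all
  qed
  also have "\<dots> \<le> 4 * (norm x + norm y)\<^sup>2"
    using le[of 1] le[of "- 1"] le[of \<i>] le[of "- \<i>"]
    unfolding norm_minus_cancel norm_one norm_ii by linarith
  finally show ?thesis by simp
qed

text \<open>Formal combinations are lists, with repetitions allowed, so that appending is addition.
  Feeding one list to two families at once produces the graph of the linear map between their
  spans.\<close>

definition comb :: "('g \<Rightarrow> 'a::complex_inner) \<Rightarrow> (complex \<times> 'g) list \<Rightarrow> 'a" where
  "comb v l = (\<Sum>(c, g)\<leftarrow>l. c *\<^sub>C v g)"

lemma comb_Nil [simp]: "comb v [] = 0" by (simp add: comb_def)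

lemma comb_Cons: "comb v ((c, g) # l) = c *\<^sub>C v g + comb v l" by (simp add: comb_def)

lemma comb_append: "comb v (l @ l') = comb v l + comb v l'" by (simp add: comb_def)

lemma comb_scale: "comb v (map (\<lambda>(c, g). (a * c, g)) l) = a *\<^sub>C comb v l"
  by (induction l) (auto simp: comb_Cons scaleC_add_right scaleC_scaleC)

lemma comb_reindex: "comb v (map (\<lambda>(c, g). (c, f g)) l) = comb (\<lambda>g. v (f g)) l"
  by (induction l) (auto simp: comb_Cons)

text \<open>The sesquilinear form attached to \<phi> on formal combinations. The argument
  \<open>- h + g\<close> is h^-1 g, as in <L(g) \<psi>, L(h) \<psi>> = \<phi>(h^-1 g).\<close>

definition gram :: "('g::group_add \<Rightarrow> complex) \<Rightarrow> (complex \<times> 'g) list \<Rightarrow> (complex \<times> 'g) list \<Rightarrow> complex" where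
  "gram \<phi> l l' = (\<Sum>(a, g)\<leftarrow>l. \<Sum>(b, h)\<leftarrow>l'. a * cnj b * \<phi> (- h + g))"

lemma cinner_comb:
  assumes "\<And>g h. cinner (v g) (w h) = \<phi> (- h + g)"
  shows "cinner (comb v l) (comb w l') = gram \<phi> l l'"
proof (induction l)
  case (Cons p l)
  obtain a g where p: "p = (a, g)" by force
  have "cinner (v g) (comb w l') = (\<Sum>(b, h)\<leftarrow>l'. cnj b * \<phi> (- h + g))"
    by (induction l') (auto simp: comb_Cons cinner_add_right cinner_scaleC_right assms)
  then show ?case using Cons
    by (simp add: p comb_Cons cinner_add_left cinner_scaleC_left gram_def sum_list_const_mult[symmetric]
        case_prod_unfold mult.assoc)
qed (simp add: gram_def)

section \<open>Square-summable positive definite functions\<close>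

lemma left_translation_bij: "bij (\<lambda>x. (g :: 'g::group_add) + x)"
  by (rule bij_betw_byWitness[where f' = "\<lambda>x. - g + x"]) (auto simp: add.assoc[symmetric])

lift_definition translate :: "'g::group_add \<Rightarrow> 'g l2 \<Rightarrow> 'g l2" is left_regular
  unfolding left_regular_def
  by (subst summable_on_reindex_bij_betw[OF left_translation_bij])

lemma translate_apply: "l2_apply (translate g a) x = l2_apply a (- g + x)"
  by transfer (simp add: left_regular_def)

lift_definition unit_l2 :: "'g \<Rightarrow> 'g l2" is "\<lambda>g x. if x = g then 1 else 0"
proof -
  fix g :: 'g
  have "(\<lambda>x. (cmod (if x = g then 1 else 0))\<^sup>2) summable_on {g}" by simp
  then show "(\<lambda>x. (cmod (if x = g then 1 else 0))\<^sup>2) summable_on UNIV"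
    by (rule summable_on_cong_neutral[THEN iffD1, rotated -1]) auto
qed

lemma cinner_unit_l2: "cinner a (unit_l2 g) = l2_apply a g"
proof -
  have "(\<Sum>\<^sub>\<infinity>x. l2_apply a x * cnj (if x = g then 1 else 0)) = (\<Sum>\<^sub>\<infinity>x\<in>{g}. l2_apply a x)"
    by (rule infsum_cong_neutral) auto
  then show ?thesis by (simp add: cinner_l2.rep_eq unit_l2.rep_eq)
qed

lemma l2_eqI: "(\<And>x. l2_apply a x = l2_apply b x) \<Longrightarrow> a = b"
  by transfer (simp add: fun_eq_iff)

lemma translate_unit_l2: "translate h (unit_l2 g) = unit_l2 (h + g)"
proof (rule l2_eqI)
  fix x
  have "- h + x = g \<longleftrightarrow> x = h + g" by (metis add_minus_cancel minus_add_cancel)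
  then show "l2_apply (translate h (unit_l2 g)) x = l2_apply (unit_l2 (h + g)) x"
    by (simp add: translate_apply unit_l2.rep_eq)
qed

lemma translate_add: "translate g (a + b) = translate g a + translate g b"
  by (rule l2_eqI) (simp add: translate_apply plus_l2.rep_eq)

lemma translate_scaleC: "translate g (c *\<^sub>C a) = c *\<^sub>C translate g a"
  by (rule l2_eqI) (simp add: translate_apply scaleC_l2.rep_eq)

lemma translate_0 [simp]: "translate 0 a = a"
  by (rule l2_eqI) (simp add: translate_apply)

lemma translate_translate: "translate g (translate h a) = translate (g + h) a"
  by (rule l2_eqI) (simp add: translate_apply minus_add add.assoc flip: add_uminus_conv_diff)

lemma cinner_translate: "cinner (translate g a) (translate g b) = cinner a b"
  unfolding cinner_l2.rep_eq translate_apply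
  by (rule infsum_reindex_bij_betw[OF left_translation_bij, of "\<lambda>x. l2_apply a x * cnj (l2_apply b x)"])

lemma norm_translate: "norm (translate g a) = norm a"
  by (simp add: norm_eq_sqrt_cinner cinner_translate)

lemma translate_comb: "translate g (comb v l) = comb (\<lambda>h. translate g (v h)) l"
  by (induction l) (auto simp: comb_Cons translate_add translate_scaleC l2_eqI translate_apply zero_l2.rep_eq)

lemma bounded_linear_translate: "bounded_linear (translate g)"
  by (rule bounded_linear_intro[where K = 1])
    (simp_all add: translate_add translate_scaleC scaleR_scaleC norm_translate)

lemma bounded_linear_scaleC: "bounded_linear (\<lambda>x :: 'a::complex_inner. c *\<^sub>C x)"
  by (rule bounded_linear_intro[where K = "cmod c"])
    (simp_all add: scaleC_add_right scaleR_scaleC scaleC_scaleC norm_scaleC mult.commute)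

theorem positive_definite_square_summable_coefficient:
  fixes \<phi> :: "'g::group_add \<Rightarrow> complex"
  assumes summable: "(\<lambda>x. (cmod (\<phi> x))\<^sup>2) summable_on UNIV"
    and positive: "\<And>l. 0 \<le> Re (gram \<phi> l l)"
    and hermitian: "\<And>g. \<phi> (- g) = cnj (\<phi> g)"
  obtains \<psi> where "\<And>h. cinner (translate h \<psi>) \<psi> = \<phi> h"
proof -
  have "(\<lambda>x. (cmod (\<phi> (- x)))\<^sup>2) summable_on UNIV" using summable by (simp add: hermitian)
  \<comment> \<open>The inversion makes <L(g) \<eta>, delta_h> equal to
    \<open>\<phi> (- h + g)\<close>, so that the form of M is exactly
    \<open>gram \<phi>\<close>.\<close>
  then obtain \<eta> where \<eta>: "l2_apply \<eta> = (\<lambda>x. \<phi> (- x))" 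
    using Abs_l2_inverse[of "\<lambda>x. \<phi> (- x)"] by simp
  define Y where "Y = comb (unit_l2 :: 'g \<Rightarrow> 'g l2)"
  define M where "M = comb (\<lambda>g. translate g \<eta>)"
  define \<Gamma> where "\<Gamma> = range (\<lambda>l. (Y l, M l))"
  have MY: "cinner (M l) (Y l') = gram \<phi> l l'" for l l'
    unfolding M_def Y_def by (rule cinner_comb) (simp add: cinner_unit_l2 translate_apply \<eta> minus_add)
  have YM: "cinner (Y l) (M l') = gram \<phi> l l'" for l l'
    unfolding M_def Y_def
    by (rule cinner_comb) (simp add: cinner_commute[of "unit_l2 _"] cinner_unit_l2 translate_apply \<eta>
        minus_add flip: hermitian)
  \<comment> \<open>Complex scalars, although the locale asks for a real subspace only: the case c =
    i later gives complex linearity of the resolvent.\<close>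
  have scale: "(c *\<^sub>C y, c *\<^sub>C m) \<in> \<Gamma>" if ym: "(y, m) \<in> \<Gamma>" for c y m
  proof -
    obtain l where "y = Y l" "m = M l" using ym by (auto simp: \<Gamma>_def)
    then have "(c *\<^sub>C y, c *\<^sub>C m) = (Y (map (\<lambda>(a, g). (c * a, g)) l), M (map (\<lambda>(a, g). (c * a, g)) l))"
      by (simp add: Y_def M_def comb_scale)
    then show ?thesis unfolding \<Gamma>_def by blast
  qed
  have trans: "(translate h y, translate h m) \<in> \<Gamma>" if ym: "(y, m) \<in> \<Gamma>" for h y m
  proof -
    obtain l where "y = Y l" "m = M l" using ym by (auto simp: \<Gamma>_def)
    then have "(translate h y, translate h m) = (Y (map (\<lambda>(a, g). (a, h + g)) l), M (map (\<lambda>(a, g). (a, h + g)) l))"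
      by (simp add: Y_def M_def comb_reindex translate_comb translate_unit_l2 translate_translate)
    then show ?thesis unfolding \<Gamma>_def by blast
  qed
  interpret positive_symmetric_relation \<Gamma>
  proof
    show "subspace \<Gamma>"
    proof (rule subspaceI)
      show "0 \<in> \<Gamma>" unfolding \<Gamma>_def by (rule image_eqI[of _ _ "[]"]) (simp_all add: Y_def M_def zero_prod_def)
      fix p q assume "p \<in> \<Gamma>" "q \<in> \<Gamma>"
      then obtain l l' where "p = (Y l, M l)" "q = (Y l', M l')" by (auto simp: \<Gamma>_def)
      then have "p + q = (Y (l @ l'), M (l @ l'))" by (simp add: Y_def M_def comb_append)
      then show "p + q \<in> \<Gamma>" unfolding \<Gamma>_def by blast
    next
      fix c :: real and p assume "p \<in> \<Gamma>"
      then show "c *\<^sub>R p \<in> \<Gamma>" using scale[of "fst p" "snd p" "of_real c"]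
        by (simp add: scaleR_prod_def scaleR_scaleC)
    qed
    fix y m z k assume "(y, m) \<in> \<Gamma>" "(z, k) \<in> \<Gamma>"
    then show "inner m z = inner y k"
      by (auto simp: \<Gamma>_def inner_l2_eq_Re_cinner MY YM)
  next
    fix y m assume "(y, m) \<in> \<Gamma>"
    then show "0 \<le> inner m y" by (auto simp: \<Gamma>_def inner_l2_eq_Re_cinner MY positive)
  qed
  define w where "w = unit_l2 0 + \<eta>"
  have "(unit_l2 0, \<eta>) = (Y [(1, 0)], M [(1, 0)])"
    by (simp add: Y_def M_def comb_Cons scaleC_one)
  then have Cw: "resolvent w = unit_l2 0" unfolding w_def by (intro resolvent_graph) (auto simp: \<Gamma>_def)
  define C where "C = Blinfun resolvent"
  have C: "blinfun_apply C = resolvent"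
    unfolding C_def by (rule bounded_linear_Blinfun_apply[OF bounded_linear_resolvent])
  have "norm (C x) \<le> 1 * norm x" "norm (x - C x) \<le> 1 * norm x" for x
  proof -
    have "(norm (C x))\<^sup>2 \<le> norm x * norm (C x)"
      using norm_resolvent_square_le[of x] norm_cauchy_schwarz[of x "C x"] by (simp add: C)
    then show "norm (C x) \<le> 1 * norm x" by (cases "C x = 0") (simp_all add: power2_eq_square)
    have "(norm (x - C x))\<^sup>2 = (norm x)\<^sup>2 - 2 * inner x (C x) + (norm (C x))\<^sup>2"
      by (simp add: power2_norm_eq_inner inner_diff_left inner_diff_right inner_commute[of "C x" x])
    also have "\<dots> \<le> (norm x)\<^sup>2 - (norm (C x))\<^sup>2" using norm_resolvent_square_le[of x] by (simp add: C)
    finally have "(norm (x - C x))\<^sup>2 \<le> (norm x)\<^sup>2"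
      using zero_le_power2[of "norm (C x)"] by linarith
    then show "norm (x - C x) \<le> 1 * norm x" using power2_le_imp_le by force
  qed
  then have norms: "norm C \<le> 1" "norm (id_blinfun - C) \<le> 1"
    by (auto intro!: norm_blinfun_bound simp: blinfun.diff_left)
  have C_sa: "inner (C x) y = inner x (C y)" for x y by (simp add: C inner_resolvent)
  then have C_sa': "inner ((id_blinfun - C) x) y = inner x ((id_blinfun - C) y)" for x y
    by (simp add: blinfun.diff_left inner_diff_left inner_diff_right)
  \<comment> \<open>K = 1 - C gives a root S of C; below, K = C gives a root R of 1 - C.\<close>
  obtain S :: "'g l2 \<Rightarrow>\<^sub>L 'g l2" where S: "\<And>x. S (S x) = x - (id_blinfun - C) x"
    and S_sa: "\<And>x y. inner (S x) y = inner x (S y)"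
    and S_comm: "\<forall>J :: 'g l2 \<Rightarrow>\<^sub>L 'g l2. (\<forall>x. J ((id_blinfun - C) x) = (id_blinfun - C) (J x)) \<longrightarrow>
      (\<forall>x. J (S x) = S (J x))"
    by (rule sqrt_id_minus_contraction[OF norms(2) C_sa']) (rule that, assumption+)
  obtain R :: "'g l2 \<Rightarrow>\<^sub>L 'g l2" where R: "\<And>x. R (R x) = x - C x"
    and R_sa: "\<And>x y. inner (R x) y = inner x (R y)"
    and R_comm: "\<forall>J :: 'g l2 \<Rightarrow>\<^sub>L 'g l2. (\<forall>x. J (C x) = C (J x)) \<longrightarrow> (\<forall>x. J (R x) = R (J x))"
    by (rule sqrt_id_minus_contraction[OF norms(1) C_sa]) (rule that, assumption+)
  have S_comm': "J (S x) = S (J x)" if "\<And>x. J (C x) = C (J x)" for J :: "'g l2 \<Rightarrow>\<^sub>L 'g l2" and x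
    using S_comm[rule_format, of J x] by (simp add: blinfun.diff_left blinfun.diff_right that)
  define \<psi> where "\<psi> = R (S w)"
  \<comment> \<open>Stated for every J commuting with C, because the inner product here is real: J =
    L(h) gives the real part of the coefficient and J = i L(h) the imaginary part. Both roots
    commute with J, which lets S be moved across to form C w.\<close>
  have coeff: "inner (J \<psi>) \<psi> = inner (J \<eta>) (unit_l2 0)"
    if J: "\<And>x. J (C x) = C (J x)" for J :: "'g l2 \<Rightarrow>\<^sub>L 'g l2"
  proof -
    have "inner (J \<psi>) \<psi> = inner (R (S (J w))) (R (S w))"
      unfolding \<psi>_def by (simp add: R_comm[rule_format, OF J] S_comm'[OF J])
    also have "\<dots> = inner (S (J w) - C (S (J w))) (S w)" by (simp add: R_sa[symmetric] R)
    also have "\<dots> = inner (S (J w - C (J w))) (S w)" by (simp add: S_comm' blinfun.diff_right)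
    also have "\<dots> = inner (J w - C (J w)) (C w)" by (simp add: S_sa S blinfun.diff_left)
    also have "\<dots> = inner (J (w - C w)) (C w)" by (simp add: J[symmetric] blinfun.diff_right)
    also have "\<dots> = inner (J \<eta>) (unit_l2 0)" by (simp add: C Cw) (simp add: w_def)
    finally show ?thesis .
  qed
  have resolvent_translate: "resolvent (translate h x) = translate h (resolvent x)" for h x
    by (rule resolvent_commute[OF bounded_linear.linear[OF bounded_linear_translate],
          where J' = "translate (- h)"])
      (use trans in \<open>auto simp: translate_translate
        inner_l2_eq_Re_cinner cinner_translate[of "- h" "translate h _", symmetric]\<close>)
  have resolvent_i: "resolvent (\<i> *\<^sub>C x) = \<i> *\<^sub>C resolvent x" for x
    by (rule resolvent_commute[OF bounded_linear.linear[OF bounded_linear_scaleC],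
          where J' = "scaleC (- \<i>)"])
      (use scale in \<open>auto simp: scaleC_scaleC scaleC_one
        inner_l2_eq_Re_cinner cinner_scaleC_left cinner_scaleC_right\<close>)
  have "cinner (translate h \<psi>) \<psi> = \<phi> h" for h
  proof -
    define J where "J = Blinfun (translate h)"
    have J: "blinfun_apply J = translate h"
      unfolding J_def by (rule bounded_linear_Blinfun_apply[OF bounded_linear_translate])
    define I where "I = Blinfun (scaleC \<i> :: 'g l2 \<Rightarrow> 'g l2)"
    have I: "blinfun_apply I = scaleC \<i>"
      unfolding I_def by (rule bounded_linear_Blinfun_apply[OF bounded_linear_scaleC])
    have "inner (J \<psi>) \<psi> = inner (J \<eta>) (unit_l2 0)"
      by (rule coeff) (simp add: J C resolvent_translate)
    \<comment> \<open>Re (i z) = - Im z, so this supplies the imaginary parts.\<close>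
    moreover have "inner ((I o\<^sub>L J) \<psi>) \<psi> = inner ((I o\<^sub>L J) \<eta>) (unit_l2 0)"
      by (rule coeff) (simp add: I J C resolvent_translate resolvent_i)
    ultimately have "cinner (translate h \<psi>) \<psi> = cinner (translate h \<eta>) (unit_l2 0)"
      by (simp add: I J inner_l2_eq_Re_cinner cinner_scaleC_left complex_eq_iff)
    then show ?thesis by (simp add: cinner_unit_l2 translate_apply \<eta>)
  qed
  then show ?thesis using that by blast
qed

section \<open>Mean-square averages and their completion\<close>

text \<open>A seminorm for each single finite set. Its triangle inequality, applied at every index
  q, replaces calculations with limsups in \<open>ennreal\<close> by eventual inequalities between
  reals.\<close>

definition rms :: "'g set \<Rightarrow> ('g \<Rightarrow> 'h::complex_inner) \<Rightarrow> real" where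
  "rms A f = sqrt (avg A (\<lambda>g. (norm (f g))\<^sup>2))"

lemma avg_norm_square_nonneg: "0 \<le> avg A (\<lambda>g. (norm (f g))\<^sup>2)"
  by (simp add: avg_def sum_nonneg)

lemma rms_nonneg: "0 \<le> rms A f"
  by (simp add: rms_def avg_norm_square_nonneg)

lemma rms_square: "(rms A f)\<^sup>2 = avg A (\<lambda>g. (norm (f g))\<^sup>2)"
  by (simp add: rms_def avg_norm_square_nonneg)

lemma rms_eq_L2_set: "rms A f = L2_set (\<lambda>g. norm (f g)) A / sqrt (card A)"
  by (simp add: rms_def avg_def L2_set_def real_sqrt_divide)

lemma rms_add: "rms A (\<lambda>g. f g + f' g) \<le> rms A f + rms A f'"
proof -
  have "L2_set (\<lambda>g. norm (f g + f' g)) A \<le> L2_set (\<lambda>g. norm (f g) + norm (f' g)) A"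
    by (intro L2_set_mono norm_triangle_ineq) simp
  also have "\<dots> \<le> L2_set (\<lambda>g. norm (f g)) A + L2_set (\<lambda>g. norm (f' g)) A"
    by (rule L2_set_triangle_ineq)
  finally show ?thesis by (simp add: rms_eq_L2_set divide_right_mono flip: add_divide_distrib)
qed

lemma rms_scaleC: "rms A (\<lambda>g. c *\<^sub>C f g) = cmod c * rms A f"
  by (simp add: rms_eq_L2_set norm_scaleC L2_set_right_distrib)

lemma rms_diff_le: "rms A f \<le> rms A (\<lambda>g. f g - f' g) + rms A f'"
  using rms_add[of A "\<lambda>g. f g - f' g" f'] by simp

lemma rms_diff_commute: "rms A (\<lambda>g. f g - f' g) = rms A (\<lambda>g. f' g - f g)"
  by (simp add: rms_def norm_minus_commute)

lemma abs_rms_diff_le: "\<bar>rms A f - rms A f'\<bar> \<le> rms A (\<lambda>g. f g - f' g)"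
  using rms_diff_le[of A f f'] rms_diff_le[of A f' f] rms_diff_commute[of A f f'] by linarith

lemma rms_cong: "(\<And>g. g \<in> A \<Longrightarrow> f g = f' g) \<Longrightarrow> rms A f = rms A f'"
  by (simp add: rms_def avg_def)

lemma rms_zero [simp]: "rms A (\<lambda>_. 0) = 0"
  by (simp add: rms_def avg_def)

lemma rms_sum: "finite K \<Longrightarrow> rms A (\<lambda>g. \<Sum>k\<in>K. f k g) \<le> (\<Sum>k\<in>K. rms A (f k))"
proof (induction K rule: finite_induct)
  case (insert k K)
  then show ?case using rms_add[of A "f k" "\<lambda>g. \<Sum>k\<in>K. f k g"] by simp
qed simp

lemma rms_mono: "(\<And>g. g \<in> A \<Longrightarrow> norm (f g) \<le> norm (f' g)) \<Longrightarrow> rms A f \<le> rms A f'"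
  unfolding rms_eq_L2_set by (intro divide_right_mono L2_set_mono) auto

text \<open>Reduces convergence of averaged inner products to convergence of the seminorms
  \<open>rms\<close>.\<close>

lemma avg_inner_polarization:
  "4 * avg_inner \<Phi> x y q = of_real ((rms (\<Phi> q) (\<lambda>g. x g + y g))\<^sup>2)
     - of_real ((rms (\<Phi> q) (\<lambda>g. x g + (- 1) *\<^sub>C y g))\<^sup>2)
     + \<i> * of_real ((rms (\<Phi> q) (\<lambda>g. x g + \<i> *\<^sub>C y g))\<^sup>2)
     - \<i> * of_real ((rms (\<Phi> q) (\<lambda>g. x g + (- \<i>) *\<^sub>C y g))\<^sup>2)"
proof -
  have "(\<Sum>g\<in>\<Phi> q. 4 * cinner (x g) (y g)) =
      of_real (\<Sum>g\<in>\<Phi> q. (norm (x g + y g))\<^sup>2) - of_real (\<Sum>g\<in>\<Phi> q. (norm (x g + (- 1) *\<^sub>C y g))\<^sup>2)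
     + \<i> * of_real (\<Sum>g\<in>\<Phi> q. (norm (x g + \<i> *\<^sub>C y g))\<^sup>2)
     - \<i> * of_real (\<Sum>g\<in>\<Phi> q. (norm (x g + (- \<i>) *\<^sub>C y g))\<^sup>2)"
    unfolding polarization by (simp only: of_real_sum sum.distrib sum_subtractf sum_distrib_left)
  then show ?thesis
    unfolding rms_square avg_inner_def avg_def of_real_divide
    by (simp only: of_real_of_nat_eq sum_distrib_left[symmetric] times_divide_eq_right
        add_divide_distrib diff_divide_distrib)
qed

lemma eventually_rms_less:
  assumes "limsup_norm2 \<Phi> f < ennreal (e\<^sup>2)" "0 < e"
  shows "\<forall>\<^sub>F q in sequentially. rms (\<Phi> q) f < e"
proof -
  have "\<forall>\<^sub>F q in sequentially. ennreal (avg (\<Phi> q) (\<lambda>g. (norm (f g))\<^sup>2)) < ennreal (e\<^sup>2)"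
    using Limsup_lessD assms(1) unfolding limsup_norm2_def by blast
  then show ?thesis
  proof eventually_elim
    case (elim q)
    then have "(rms (\<Phi> q) f)\<^sup>2 < e\<^sup>2"
      by (simp add: rms_square ennreal_less_iff avg_norm_square_nonneg)
    then show ?case using assms(2) by (simp add: power_less_imp_less_base)
  qed
qed

lemma limsup_norm2_le:
  assumes "\<forall>\<^sub>F q in sequentially. rms (\<Phi> q) f \<le> b"
  shows "limsup_norm2 \<Phi> f \<le> ennreal (b\<^sup>2)"
  unfolding limsup_norm2_def
proof (rule Limsup_bounded)
  show "\<forall>\<^sub>F q in sequentially. ennreal (avg (\<Phi> q) (\<lambda>g. (norm (f g))\<^sup>2)) \<le> ennreal (b\<^sup>2)"
    using assms
  proof eventually_elim
    case (elim q)
    then show ?case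
      using power_mono[OF elim rms_nonneg, of 2] by (simp add: rms_square ennreal_leI)
  qed
qed

text \<open>Convergence is assumed for norms only, since inner products follow by polarization. That
  R is single-valued is not assumed: linearity and \<open>R_norm\<close> force it.\<close>

locale isometric_model =
  fixes \<Phi> :: "nat \<Rightarrow> 'g set"
    and A :: "('g \<Rightarrow> 'h::complex_inner) set"
    and R :: "(('g \<Rightarrow> 'h) \<times> 'b::{complex_inner,banach}) set"
  assumes finite: "finite (\<Phi> q)"
    and card_at_top: "filterlim (\<lambda>q. real (card (\<Phi> q))) at_top sequentially"
    and Domain_R: "x \<in> pre_space A \<longleftrightarrow> (\<exists>s. (x, s) \<in> R)"
    and R_add: "(x, s) \<in> R \<Longrightarrow> (y, t) \<in> R \<Longrightarrow> (\<lambda>g. x g + y g, s + t) \<in> R"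
    and R_scale: "(x, s) \<in> R \<Longrightarrow> (\<lambda>g. c *\<^sub>C x g, c *\<^sub>C s) \<in> R"
    and R_norm: "(x, s) \<in> R \<Longrightarrow> (\<lambda>q. rms (\<Phi> q) x) \<longlonglongrightarrow> norm s"
begin

text \<open>\<open>R\<close> is the graph of a linear isometry on the span of \<open>A\<close>; \<open>img\<close> is the graph of its
  continuous extension to \<open>ext_space A \<Phi>\<close>.\<close>

definition img :: "('g \<Rightarrow> 'h) \<Rightarrow> 'b \<Rightarrow> bool" where
  "img E w \<longleftrightarrow> (\<forall>e>0. \<exists>x s. (x, s) \<in> R \<and>
     (\<forall>\<^sub>F q in sequentially. rms (\<Phi> q) (\<lambda>g. E g - x g) < e) \<and> norm (s - w) < e)"

lemma R_diff: "(x, s) \<in> R \<Longrightarrow> (y, t) \<in> R \<Longrightarrow> (\<lambda>g. x g - y g, s - t) \<in> R"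
  using R_add[OF _ R_scale[where c = "- 1"]] by fastforce

text \<open>Approximability by the span already implies membership in \<open>SA\<close>, as
  seminorms converge on the span and hence are eventually bounded.\<close>

lemma ext_space_iff:
  "E \<in> ext_space A \<Phi> \<longleftrightarrow>
     (\<forall>e>0. \<exists>x\<in>pre_space A. \<forall>\<^sub>F q in sequentially. rms (\<Phi> q) (\<lambda>g. E g - x g) < e)"
proof
  assume E: "E \<in> ext_space A \<Phi>"
  show "\<forall>e>0. \<exists>x\<in>pre_space A. \<forall>\<^sub>F q in sequentially. rms (\<Phi> q) (\<lambda>g. E g - x g) < e"
  proof (intro allI impI)
    fix e :: real assume "0 < e"
    then have "0 < e\<^sup>2" by simp
    then obtain x where "x \<in> pre_space A" "limsup_norm2 \<Phi> (\<lambda>g. E g - x g) < ennreal (e\<^sup>2)"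
      using E unfolding ext_space_def by blast
    then show "\<exists>x\<in>pre_space A. \<forall>\<^sub>F q in sequentially. rms (\<Phi> q) (\<lambda>g. E g - x g) < e"
      using eventually_rms_less \<open>0 < e\<close> by blast
  qed
next
  assume *: "\<forall>e>0. \<exists>x\<in>pre_space A. \<forall>\<^sub>F q in sequentially. rms (\<Phi> q) (\<lambda>g. E g - x g) < e"
  obtain x where x: "x \<in> pre_space A" and ev1: "\<forall>\<^sub>F q in sequentially. rms (\<Phi> q) (\<lambda>g. E g - x g) < 1"
    using * zero_less_one by blast
  obtain s where "(x, s) \<in> R" using Domain_R x by blast
  then have ev2: "\<forall>\<^sub>F q in sequentially. rms (\<Phi> q) x < norm s + 1"
    using order_tendstoD(2)[OF R_norm] by force
  have "\<forall>\<^sub>F q in sequentially. rms (\<Phi> q) E \<le> norm s + 2"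
    using ev1 ev2
  proof eventually_elim
    case (elim q)
    then show ?case using rms_diff_le[of "\<Phi> q" E x] by linarith
  qed
  then have "limsup_norm2 \<Phi> E \<le> ennreal ((norm s + 2)\<^sup>2)" by (rule limsup_norm2_le)
  then have "E \<in> SA \<Phi>" unfolding SA_def using ennreal_less_top order_le_less_trans by fastforce
  moreover have "\<exists>x\<in>pre_space A. limsup_norm2 \<Phi> (\<lambda>g. E g - x g) < ennreal e" if "0 < e" for e
  proof -
    \<comment> \<open>An eventual bound only yields a non-strict bound on the limsup; halving e
      restores the strict inequality.\<close>
    have pos: "0 < sqrt (e / 2)" using that by simp
    obtain x where x: "x \<in> pre_space A"
      and ev: "\<forall>\<^sub>F q in sequentially. rms (\<Phi> q) (\<lambda>g. E g - x g) < sqrt (e / 2)"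
      using * pos by blast
    have "limsup_norm2 \<Phi> (\<lambda>g. E g - x g) \<le> ennreal ((sqrt (e / 2))\<^sup>2)"
      by (rule limsup_norm2_le, rule eventually_mono[OF ev]) simp
    also have "\<dots> < ennreal e" using that by (simp add: ennreal_less_iff)
    finally show ?thesis using x by blast
  qed
  ultimately show "E \<in> ext_space A \<Phi>" unfolding ext_space_def by blast
qed

lemma img_imp_ext: "img E w \<Longrightarrow> E \<in> ext_space A \<Phi>"
  unfolding ext_space_iff img_def using Domain_R by blast

lemma img_R: "(x, s) \<in> R \<Longrightarrow> img x s"
  unfolding img_def by (intro allI impI exI[of _ x] exI[of _ s]) auto

lemma img_norm:
  assumes "img E w"
  shows "(\<lambda>q. rms (\<Phi> q) E) \<longlonglongrightarrow> norm w"
proof (rule tendstoI)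
  fix e :: real assume "0 < e"
  then have "0 < e / 3" by simp
  then obtain x s where xs: "(x, s) \<in> R" and "norm (s - w) < e / 3"
    and ev: "\<forall>\<^sub>F q in sequentially. rms (\<Phi> q) (\<lambda>g. E g - x g) < e / 3"
    using assms unfolding img_def by blast
  then have sw: "\<bar>norm s - norm w\<bar> < e / 3" using norm_triangle_ineq3[of s w] by linarith
  have "\<forall>\<^sub>F q in sequentially. dist (rms (\<Phi> q) x) (norm s) < e / 3"
    using R_norm[OF xs] \<open>0 < e / 3\<close> tendstoD by blast
  with ev show "\<forall>\<^sub>F q in sequentially. dist (rms (\<Phi> q) E) (norm w) < e"
  proof eventually_elim
    case (elim q)
    then show ?case using abs_rms_diff_le[of "\<Phi> q" E x] sw unfolding dist_real_def by argo
  qed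
qed

lemma img_add:
  assumes "img E w" "img E' w'"
  shows "img (\<lambda>g. E g + E' g) (w + w')"
  unfolding img_def
proof (intro allI impI)
  fix e :: real assume "0 < e"
  then have "0 < e / 2" by simp
  then obtain x s x' s' where R: "(x, s) \<in> R" "(x', s') \<in> R"
    and ev: "\<forall>\<^sub>F q in sequentially. rms (\<Phi> q) (\<lambda>g. E g - x g) < e / 2"
      "\<forall>\<^sub>F q in sequentially. rms (\<Phi> q) (\<lambda>g. E' g - x' g) < e / 2"
    and n: "norm (s - w) < e / 2" "norm (s' - w') < e / 2"
    using assms unfolding img_def by meson
  have "\<forall>\<^sub>F q in sequentially. rms (\<Phi> q) (\<lambda>g. E g + E' g - (x g + x' g)) < e"
    using ev
  proof eventually_elim
    case (elim q)
    then show ?case using rms_add[of "\<Phi> q" "\<lambda>g. E g - x g" "\<lambda>g. E' g - x' g"]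
      by (simp add: algebra_simps)
  qed
  moreover have "norm (s + s' - (w + w')) < e"
    using n norm_triangle_ineq[of "s - w" "s' - w'"] by (simp add: algebra_simps)
  ultimately show "\<exists>x s. (x, s) \<in> R \<and>
      (\<forall>\<^sub>F q in sequentially. rms (\<Phi> q) (\<lambda>g. E g + E' g - x g) < e) \<and> norm (s - (w + w')) < e"
    using R_add[OF R] by (intro exI[of _ "\<lambda>g. x g + x' g"] exI[of _ "s + s'"]) simp
qed

lemma img_scale:
  assumes "img E w"
  shows "img (\<lambda>g. c *\<^sub>C E g) (c *\<^sub>C w)"
  unfolding img_def
proof (intro allI impI)
  fix e :: real assume "0 < e"
  define d where "d = e / (cmod c + 1)"
  have pos: "0 < cmod c + 1" by (simp add: add_nonneg_pos)
  have d: "0 < d" using \<open>0 < e\<close> pos by (simp add: d_def)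
  have less: "cmod c * t < e" if "t < d" "0 \<le> t" for t
  proof -
    have "cmod c * t \<le> (cmod c + 1) * t" using that by (intro mult_right_mono) auto
    also have "\<dots> < (cmod c + 1) * d" using that pos by simp
    also have "\<dots> = e" using pos by (simp add: d_def)
    finally show ?thesis .
  qed
  obtain x s where R: "(x, s) \<in> R"
    and ev: "\<forall>\<^sub>F q in sequentially. rms (\<Phi> q) (\<lambda>g. E g - x g) < d" and n: "norm (s - w) < d"
    using assms d unfolding img_def by meson
  have "\<forall>\<^sub>F q in sequentially. rms (\<Phi> q) (\<lambda>g. c *\<^sub>C E g - c *\<^sub>C x g) < e"
    using ev by eventually_elim (simp add: rms_scaleC less rms_nonneg flip: scaleC_diff_right)
  moreover have "norm (c *\<^sub>C s - c *\<^sub>C w) < e"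
    using n by (simp add: norm_scaleC less flip: scaleC_diff_right)
  ultimately show "\<exists>x s. (x, s) \<in> R \<and>
      (\<forall>\<^sub>F q in sequentially. rms (\<Phi> q) (\<lambda>g. c *\<^sub>C E g - x g) < e) \<and> norm (s - c *\<^sub>C w) < e"
    using R_scale[OF R] by blast
qed

lemma img_diff: "img E w \<Longrightarrow> img E' w' \<Longrightarrow> img (\<lambda>g. E g - E' g) (w - w')"
  using img_add[OF _ img_scale[where c = "- 1"]] by fastforce

text \<open>The difference of the two images belongs to the zero function, whose seminorms
  vanish.\<close>

lemma img_unique:
  assumes "img E w" "img E w'"
  shows "w = w'"
proof -
  have "(\<lambda>q. rms (\<Phi> q) (\<lambda>g. E g - E g)) \<longlonglongrightarrow> norm (w - w')" by (rule img_norm[OF img_diff[OF assms]])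
  then show ?thesis by (simp add: LIMSEQ_const_iff)
qed

lemma img_inner:
  assumes "img E w" "img E' w'"
  shows "avg_inner \<Phi> E E' \<longlonglongrightarrow> cinner w w'"
proof -
  have rms: "(\<lambda>q. rms (\<Phi> q) (\<lambda>g. E g + c *\<^sub>C E' g)) \<longlonglongrightarrow> norm (w + c *\<^sub>C w')" for c
    by (intro img_norm img_add img_scale assms)
  have "(\<lambda>q. 4 * avg_inner \<Phi> E E' q) \<longlonglongrightarrow> 4 * cinner w w'"
    unfolding avg_inner_polarization polarization[of w w']
    by (intro tendsto_intros rms img_norm img_add assms)
  then show ?thesis using tendsto_mult_left_iff[of 4 "avg_inner \<Phi> E E'"] by simp
qed

lemma img_exists:
  assumes "E \<in> ext_space A \<Phi>"
  obtains w where "img E w"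
proof -
  have "\<exists>p. p \<in> R \<and> (\<forall>\<^sub>F q in sequentially. rms (\<Phi> q) (\<lambda>g. E g - fst p g) < inverse (real (Suc n)))" for n
  proof -
    have "0 < inverse (real (Suc n))" by simp
    then obtain x where "x \<in> pre_space A"
      "\<forall>\<^sub>F q in sequentially. rms (\<Phi> q) (\<lambda>g. E g - x g) < inverse (real (Suc n))"
      using assms unfolding ext_space_iff by blast
    then show ?thesis using Domain_R by (metis fst_conv)
  qed
  then obtain p where p: "\<And>n. p n \<in> R"
    and ev: "\<And>n. \<forall>\<^sub>F q in sequentially. rms (\<Phi> q) (\<lambda>g. E g - fst (p n) g) < inverse (real (Suc n))"
    by metis
  have R: "(fst (p n), snd (p n)) \<in> R" for n using p by simp
  have gap: "norm (snd (p m) - snd (p n)) \<le> inverse (real (Suc m)) + inverse (real (Suc n))" for m n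
  proof (rule tendsto_upperbound)
    show "(\<lambda>q. rms (\<Phi> q) (\<lambda>g. fst (p m) g - fst (p n) g)) \<longlonglongrightarrow> norm (snd (p m) - snd (p n))"
      by (rule R_norm[OF R_diff[OF R R]])
    show "\<forall>\<^sub>F q in sequentially. rms (\<Phi> q) (\<lambda>g. fst (p m) g - fst (p n) g)
        \<le> inverse (real (Suc m)) + inverse (real (Suc n))"
      using ev[of m] ev[of n]
    proof eventually_elim
      case (elim q)
      then show ?case
        using rms_add[of "\<Phi> q" "\<lambda>g. fst (p m) g - E g" "\<lambda>g. E g - fst (p n) g"]
          rms_diff_commute[of "\<Phi> q" E "fst (p m)"] by simp
    qed
  qed simp
  have "Cauchy (\<lambda>n. snd (p n))"
  proof (rule CauchyI)
    fix e :: real assume "0 < e"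
    then obtain N where N: "inverse (real (Suc N)) < e / 2" using reals_Archimedean[of "e / 2"] by auto
    have small: "inverse (real (Suc k)) < e / 2" if "N \<le> k" for k
    proof -
      have "inverse (real (Suc k)) \<le> inverse (real (Suc N))"
        using that by (intro le_imp_inverse_le) auto
      then show ?thesis using N by linarith
    qed
    have "norm (snd (p m) - snd (p n)) < e" if "N \<le> m" "N \<le> n" for m n
      using gap[of m n] small[OF that(1)] small[OF that(2)] by linarith
    then show "\<exists>N. \<forall>m\<ge>N. \<forall>n\<ge>N. norm (snd (p m) - snd (p n)) < e" by blast
  qed
  then obtain w where w: "(\<lambda>n. snd (p n)) \<longlonglongrightarrow> w" using Cauchy_convergent_iff convergent_def by blast
  have "img E w"
    unfolding img_def
  proof (intro allI impI)
    fix e :: real assume "0 < e"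
    then have "\<forall>\<^sub>F n in sequentially. norm (snd (p n) - w) < e"
      using tendstoD[OF w] by (simp add: dist_norm)
    moreover have "\<forall>\<^sub>F n in sequentially. inverse (real (Suc n)) < e"
      using order_tendstoD(2)[OF LIMSEQ_inverse_real_of_nat] \<open>0 < e\<close> by blast
    ultimately have "\<forall>\<^sub>F n in sequentially. norm (snd (p n) - w) < e \<and> inverse (real (Suc n)) < e"
      by (rule eventually_conj)
    then obtain n where n: "norm (snd (p n) - w) < e" "inverse (real (Suc n)) < e"
      using eventually_happens' sequentially_bot by blast
    have "\<forall>\<^sub>F q in sequentially. rms (\<Phi> q) (\<lambda>g. E g - fst (p n) g) < e"
      using ev[of n] by eventually_elim (use n in linarith)
    then show "\<exists>x s. (x, s) \<in> R \<and> (\<forall>\<^sub>F q in sequentially. rms (\<Phi> q) (\<lambda>g. E g - x g) < e) \<and> norm (s - w) < e"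
      using R n by blast
  qed
  then show ?thesis by (rule that)
qed

lemma rms_finite_support:
  assumes "finite S" "\<And>g. g \<notin> S \<Longrightarrow> f g = 0"
  shows "(\<lambda>q. rms (\<Phi> q) f) \<longlonglongrightarrow> 0"
proof -
  define B where "B = (\<Sum>g\<in>S. (norm (f g))\<^sup>2)"
  have "(\<lambda>q. avg (\<Phi> q) (\<lambda>g. (norm (f g))\<^sup>2)) \<longlonglongrightarrow> 0"
  proof (rule tendsto_sandwich[where f = "\<lambda>_. 0" and h = "\<lambda>q. B / real (card (\<Phi> q))"])
    have "(\<Sum>g\<in>\<Phi> q. (norm (f g))\<^sup>2) \<le> B" for q
    proof -
      have "(\<Sum>g\<in>\<Phi> q. (norm (f g))\<^sup>2) = (\<Sum>g\<in>\<Phi> q \<inter> S. (norm (f g))\<^sup>2)"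
        using assms finite by (intro sum.mono_neutral_right) auto
      also have "\<dots> \<le> B" unfolding B_def using assms by (intro sum_mono2) auto
      finally show ?thesis .
    qed
    then show "\<forall>\<^sub>F q in sequentially. avg (\<Phi> q) (\<lambda>g. (norm (f g))\<^sup>2) \<le> B / real (card (\<Phi> q))"
      by (intro always_eventually) (simp add: avg_def divide_right_mono)
    show "(\<lambda>q. B / real (card (\<Phi> q))) \<longlonglongrightarrow> 0"
      by (rule real_tendsto_divide_at_top[OF tendsto_const card_at_top])
    show "\<forall>\<^sub>F q in sequentially. 0 \<le> avg (\<Phi> q) (\<lambda>g. (norm (f g))\<^sup>2)"
      by (simp add: avg_norm_square_nonneg)
  qed simp
  then have "(\<lambda>q. sqrt (avg (\<Phi> q) (\<lambda>g. (norm (f g))\<^sup>2))) \<longlonglongrightarrow> sqrt 0" by (rule tendsto_real_sqrt)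
  then show ?thesis by (simp add: rms_def)
qed

text \<open>Completeness. With \<open>x\<^sub>k\<close> in the span of \<open>A\<close> whose images converge fast to \<open>w\<close>, the preimage is
  \<open>E = x\<^sub>0 + (\<Sum>k. D\<^sub>k)\<close>, where \<open>D\<^sub>k\<close> is \<open>x\<^bsub>k+1\<^esub> - x\<^sub>k\<close> cut off to zero on the finite set
  \<open>S\<^sub>k = (\<Union>q<r\<^sub>k. \<Phi> q)\<close>. The cut-off makes the mean square of \<open>D\<^sub>k\<close> small on every \<open>\<Phi> q\<close>, and it
  only changes partial sums on finite sets, which are negligible since \<open>card (\<Phi> q)\<close> tends to
  infinity.\<close>

lemma img_surj:
  assumes "\<And>e. 0 < e \<Longrightarrow> \<exists>x s. (x, s) \<in> R \<and> norm (s - w) < e"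
  obtains E where "img E w"
proof -
  \<comment> \<open>The factor 1/4 makes consecutive images closer than (1/4 + 1/8) (1/2)^k, hence
    strictly closer than (1/2)^k.\<close>
  have "\<exists>p. p \<in> R \<and> norm (snd p - w) < (1/2) ^ n / 4" for n
    using assms[of "(1/2) ^ n / 4"] by auto
  then obtain p where p: "\<And>n. p n \<in> R" and pw: "\<And>n. norm (snd (p n) - w) < (1/2) ^ n / 4" by metis
  define x where "x n = fst (p n)" for n
  define s where "s n = snd (p n)" for n
  have R: "(x n, s n) \<in> R" for n using p by (simp add: x_def s_def)
  have sw: "norm (s n - w) < (1/2) ^ n / 4" for n using pw by (simp add: s_def)
  define D where "D k g = x (Suc k) g - x k g" for k g
  have "\<forall>\<^sub>F q in sequentially. rms (\<Phi> q) (D k) < (1/2) ^ k" for k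
  proof -
    have "norm (s (Suc k) - s k) < (1/2) ^ k"
    proof -
      have "0 < (1/2 :: real) ^ k" "(1/2 :: real) ^ Suc k = (1/2) ^ k / 2"
        "norm (s (Suc k) - s k) \<le> norm (s (Suc k) - w) + norm (s k - w)"
        using norm_triangle_ineq4[of "s (Suc k) - w" "s k - w"] by simp_all
      then show ?thesis using sw[of k] sw[of "Suc k"] by linarith
    qed
    moreover have "(\<lambda>q. rms (\<Phi> q) (D k)) \<longlonglongrightarrow> norm (s (Suc k) - s k)"
      using R_norm[OF R_diff[OF R R]] unfolding D_def by blast
    ultimately show ?thesis using order_tendstoD(2) by blast
  qed
  \<comment> \<open>Requiring \<open>k \<le> r k\<close> puts every point of \<Phi> q into S k for
    all k > q, so at such a point only finitely many terms survive the cut-off.\<close>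
  then have "\<exists>N\<ge>k. \<forall>q\<ge>N. rms (\<Phi> q) (D k) < (1/2) ^ k" for k
    unfolding eventually_sequentially by (meson max.cobounded1 max.cobounded2 order_trans)
  then obtain r where r: "\<And>k. k \<le> r k" "\<And>k q. r k \<le> q \<Longrightarrow> rms (\<Phi> q) (D k) < (1/2) ^ k" by metis
  define S where "S k = (\<Union>q<r k. \<Phi> q)" for k
  \<comment> \<open>At a point outside all the sets \<Phi> q the index set is infinite and the sum
    is 0 by convention; no average sees such points.\<close>
  define E where "E g = x 0 g + (\<Sum>k | g \<notin> S k. D k g)" for g
  have tail: "rms (\<Phi> q) (\<lambda>g. if g \<in> S k then 0 else D k g) \<le> (1/2) ^ k" for q k
  proof (cases "q < r k")
    case True
    then have "rms (\<Phi> q) (\<lambda>g. if g \<in> S k then 0 else D k g) = rms (\<Phi> q) (\<lambda>_. 0 :: 'h)"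
      by (intro rms_cong) (auto simp: S_def)
    then show ?thesis by simp
  next
    case False
    have "rms (\<Phi> q) (\<lambda>g. if g \<in> S k then 0 else D k g) \<le> rms (\<Phi> q) (D k)"
      by (intro rms_mono) auto
    then show ?thesis using r(2)[of k q] False by simp
  qed
  have geom: "(\<Sum>k\<in>{n..<m}. (1/2) ^ k) \<le> 2 * (1/2 :: real) ^ n" if "n \<le> m" for n m
  proof -
    have "(\<Sum>k\<in>{n..<m}. (1/2) ^ k) = 2 * (1/2 :: real) ^ n - 2 * (1/2) ^ m"
      using that
    proof (induction m rule: dec_induct)
      case (step k)
      have "(\<Sum>k\<in>{n..<Suc k}. (1/2) ^ k) = (\<Sum>k\<in>{n..<k}. (1/2) ^ k) + (1/2 :: real) ^ k"
        using step.hyps by (intro sum.atLeastLessThan_Suc) simp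
      moreover have "(1/2 :: real) ^ Suc k = (1/2) ^ k / 2" by simp
      ultimately show ?case using step.IH by linarith
    qed simp
    then show ?thesis by simp
  qed
  have close: "\<forall>\<^sub>F q in sequentially. rms (\<Phi> q) (\<lambda>g. E g - x n g) < 3 * (1/2) ^ n" for n
  proof -
    \<comment> \<open>H collects what the cut-off removes from the first n differences. On \<Phi> q,
      E - x n is T - H with T the tail: H is eventually below (1/2)^n, T is at most 2 (1/2)^n, which
      explains the factor 3.\<close>
    define H where "H g = (\<Sum>k<n. if g \<in> S k then D k g else 0)" for g
    have "(\<lambda>q. rms (\<Phi> q) H) \<longlonglongrightarrow> 0"
    proof (rule rms_finite_support)
      show "Finite_Set.finite (\<Union>k<n. S k)" using finite by (auto simp: S_def)
      show "H g = 0" if "g \<notin> (\<Union>k<n. S k)" for g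
        unfolding H_def using that by (intro sum.neutral) auto
    qed
    then have "\<forall>\<^sub>F q in sequentially. rms (\<Phi> q) H < (1/2) ^ n"
      using order_tendstoD(2)[of _ 0] by force
    moreover have "\<forall>\<^sub>F q in sequentially. n \<le> q" by (rule eventually_ge_at_top)
    ultimately show ?thesis
    proof eventually_elim
      case (elim q)
      \<comment> \<open>Stopping at k = q is exact on \<Phi> q, since later terms are cut off
        there.\<close>
      define T where "T g = (\<Sum>k\<in>{n..<Suc q}. if g \<in> S k then 0 else D k g)" for g
      have "E g - x n g = (- 1) *\<^sub>C H g + T g" if "g \<in> \<Phi> q" for g
      proof -
        have "k < Suc q" if "g \<notin> S k" for k
        proof (rule ccontr)
          assume "\<not> k < Suc q"
          then have "q < r k" using r(1)[of k] by linarith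
          then show False using \<open>g \<notin> S k\<close> \<open>g \<in> \<Phi> q\<close> by (auto simp: S_def)
        qed
        then have "(\<Sum>k | g \<notin> S k. D k g) = (\<Sum>k\<in>{..<Suc q}. if g \<in> S k then 0 else D k g)"
          by (intro sum.mono_neutral_cong_left) auto
        also have "{..<Suc q} = {..<n} \<union> {n..<Suc q}" using elim by auto
        also have "(\<Sum>k\<in>\<dots>. if g \<in> S k then 0 else D k g)
            = (\<Sum>k<n. if g \<in> S k then 0 else D k g) + T g"
          unfolding T_def by (rule sum.union_disjoint) auto
        also have "(\<Sum>k<n. if g \<in> S k then 0 else D k g) = (\<Sum>k<n. D k g) - H g"
          unfolding H_def sum_subtractf[symmetric] by (rule sum.cong) auto
        also have "(\<Sum>k<n. D k g) = x n g - x 0 g"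
          unfolding D_def by (rule sum_lessThan_telescope)
        finally show ?thesis by (simp add: E_def)
      qed
      then have "rms (\<Phi> q) (\<lambda>g. E g - x n g) = rms (\<Phi> q) (\<lambda>g. (- 1) *\<^sub>C H g + T g)"
        by (rule rms_cong)
      also have "\<dots> \<le> rms (\<Phi> q) H + rms (\<Phi> q) T"
        using rms_add[of "\<Phi> q" "\<lambda>g. (- 1) *\<^sub>C H g" T] unfolding rms_scaleC by simp
      also have "rms (\<Phi> q) T \<le> (\<Sum>k\<in>{n..<Suc q}. (1/2) ^ k)"
        unfolding T_def by (rule order_trans[OF rms_sum sum_mono[OF tail]]) simp
      also have "\<dots> \<le> 2 * (1/2) ^ n" using elim by (intro geom) simp
      finally show ?case using elim by simp
    qed
  qed
  have "img E w"
    unfolding img_def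
  proof (intro allI impI)
    fix e :: real assume "0 < e"
    then obtain n where n: "(1/2) ^ n < e / 3" using real_arch_pow_inv[of "e / 3" "1/2"] by auto
    have "\<forall>\<^sub>F q in sequentially. rms (\<Phi> q) (\<lambda>g. E g - x n g) < e"
      using close[of n] by eventually_elim (use n in linarith)
    moreover have "0 \<le> (1/2 :: real) ^ n" by simp
    then have "norm (s n - w) < e" using sw[of n] n by linarith
    ultimately show "\<exists>x s. (x, s) \<in> R \<and> (\<forall>\<^sub>F q in sequentially. rms (\<Phi> q) (\<lambda>g. E g - x g) < e) \<and> norm (s - w) < e"
      using R by blast
  qed
  then show ?thesis by (rule that)
qed

section \<open>Classes of functions and the unitary structure of H(P)\<close>

definition hat :: "('g \<Rightarrow> 'h) \<Rightarrow> 'b" where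
  "hat E = (THE w. img E w)"

definition target :: "'b set" where
  "target = {w. \<exists>E. img E w}"

lemma hat_eq: "img E w \<Longrightarrow> hat E = w"
  unfolding hat_def using img_unique by blast

lemma img_hat: "E \<in> ext_space A \<Phi> \<Longrightarrow> img E (hat E)"
  using img_exists hat_eq by metis

text \<open>The image of H(P) is the whole closure of the image of the span. The direction from
  right to left is the completeness of H(P), through \<open>img_surj\<close>.\<close>

lemma target_iff: "w \<in> target \<longleftrightarrow> (\<forall>e>0. \<exists>x s. (x, s) \<in> R \<and> norm (s - w) < e)"
proof
  assume "w \<in> target"
  then show "\<forall>e>0. \<exists>x s. (x, s) \<in> R \<and> norm (s - w) < e"
    unfolding target_def img_def by blast
next
  assume "\<forall>e>0. \<exists>x s. (x, s) \<in> R \<and> norm (s - w) < e"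
  then show "w \<in> target" unfolding target_def using img_surj by blast
qed

lemma target_closed:
  assumes "\<And>e. 0 < e \<Longrightarrow> \<exists>w'\<in>target. norm (w' - w) < e"
  shows "w \<in> target"
  unfolding target_iff
proof (intro allI impI)
  fix e :: real assume "0 < e"
  then obtain w' where w': "w' \<in> target" "norm (w' - w) < e / 2" using assms[of "e / 2"] by auto
  then obtain x s where xs: "(x, s) \<in> R" and s: "norm (s - w') < e / 2"
    using \<open>0 < e\<close> unfolding target_iff by (meson half_gt_zero)
  have "norm (s - w) < e" using s w' norm_triangle_ineq[of "s - w'" "w' - w"] by simp
  with xs show "\<exists>x s. (x, s) \<in> R \<and> norm (s - w) < e" by blast
qed

lemma target_add: "v \<in> target \<Longrightarrow> w \<in> target \<Longrightarrow> v + w \<in> target"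
  unfolding target_def using img_add by blast

lemma target_scaleC: "w \<in> target \<Longrightarrow> c *\<^sub>C w \<in> target"
  unfolding target_def using img_scale by blast

lemma ext_add:
  assumes "x \<in> ext_space A \<Phi>" "y \<in> ext_space A \<Phi>"
  shows "(\<lambda>g. x g + y g) \<in> ext_space A \<Phi>" "hat (\<lambda>g. x g + y g) = hat x + hat y"
  using img_add[OF img_hat img_hat, OF assms] img_imp_ext hat_eq by auto

lemma ext_scaleC:
  assumes "x \<in> ext_space A \<Phi>"
  shows "(\<lambda>g. c *\<^sub>C x g) \<in> ext_space A \<Phi>" "hat (\<lambda>g. c *\<^sub>C x g) = c *\<^sub>C hat x"
  using img_scale[OF img_hat, OF assms] img_imp_ext hat_eq by auto

lemma null_space_iff:
  assumes "x \<in> ext_space A \<Phi>"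
  shows "x \<in> null_space A \<Phi> \<longleftrightarrow> hat x = 0"
proof -
  have lim: "(\<lambda>q. avg (\<Phi> q) (\<lambda>g. (norm (x g))\<^sup>2)) \<longlonglongrightarrow> (norm (hat x))\<^sup>2"
    unfolding rms_square[symmetric] by (intro tendsto_intros img_norm img_hat assms)
  have "(\<lambda>q. avg (\<Phi> q) (\<lambda>g. (norm (x g))\<^sup>2)) \<longlonglongrightarrow> 0 \<longleftrightarrow> (norm (hat x))\<^sup>2 = 0"
    using LIMSEQ_unique[OF lim] lim by metis
  then show ?thesis using assms by (simp add: null_space_def)
qed

text \<open>The relation is the kernel of \<open>hat\<close> on \<open>ext_space\<close>, so every
  question about classes becomes one about their values in the Hilbert space.\<close>

lemma null_rel_iff:
  "(x, y) \<in> null_rel A \<Phi> \<longleftrightarrow> x \<in> ext_space A \<Phi> \<and> y \<in> ext_space A \<Phi> \<and> hat x = hat y"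
proof (cases "x \<in> ext_space A \<Phi> \<and> y \<in> ext_space A \<Phi>")
  case True
  then have "img (\<lambda>g. x g - y g) (hat x - hat y)" by (intro img_diff img_hat) auto
  then show ?thesis using True img_imp_ext hat_eq null_space_iff by (fastforce simp: null_rel_def)
qed (auto simp: null_rel_def)

lemma cls_eq: "x \<in> ext_space A \<Phi> \<Longrightarrow> cls A \<Phi> x = {y \<in> ext_space A \<Phi>. hat y = hat x}"
  by (auto simp: cls_def null_rel_iff)

text \<open>The isometry of H(P) induced by \<open>hat\<close>. The representative is chosen
  arbitrarily; \<open>val_cls\<close> shows independence of it, and injectivity is how equations
  between classes are proved below.\<close>

definition val :: "('g \<Rightarrow> 'h) set \<Rightarrow> 'b" where
  "val X = hat (SOME x. x \<in> X)"

lemma val_cls: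
  assumes "x \<in> ext_space A \<Phi>"
  shows "val (cls A \<Phi> x) = hat x"
proof -
  have "x \<in> cls A \<Phi> x" using assms by (simp add: cls_eq)
  then have "(SOME y. y \<in> cls A \<Phi> x) \<in> cls A \<Phi> x" by (rule someI[where P = "\<lambda>y. y \<in> cls A \<Phi> x"])
  then show ?thesis using assms by (simp add: cls_eq val_def)
qed

lemma carrier_iff: "X \<in> carrier (pair_space A \<Phi>) \<longleftrightarrow> (\<exists>x\<in>ext_space A \<Phi>. X = cls A \<Phi> x)"
  by (auto simp: pair_space_def quotient_def cls_def)

lemma val_inj:
  assumes "X \<in> carrier (pair_space A \<Phi>)" "Y \<in> carrier (pair_space A \<Phi>)" "val X = val Y"
  shows "X = Y"
proof -
  obtain x where x: "x \<in> ext_space A \<Phi>" "X = cls A \<Phi> x" using assms(1) carrier_iff by blast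
  obtain y where y: "y \<in> ext_space A \<Phi>" "Y = cls A \<Phi> y" using assms(2) carrier_iff by blast
  have "hat x = hat y" using assms(3) x y by (simp add: val_cls)
  then show ?thesis using x y by (simp add: cls_eq)
qed

lemma val_target: "X \<in> carrier (pair_space A \<Phi>) \<Longrightarrow> val X \<in> target"
  unfolding carrier_iff target_def using val_cls img_hat by force

lemma vadd_pair_space:
  assumes "X \<in> carrier (pair_space A \<Phi>)" "Y \<in> carrier (pair_space A \<Phi>)"
  shows "vadd (pair_space A \<Phi>) X Y \<in> carrier (pair_space A \<Phi>)"
    and "val (vadd (pair_space A \<Phi>) X Y) = val X + val Y"
proof -
  obtain x where x: "x \<in> ext_space A \<Phi>" "X = cls A \<Phi> x" using assms(1) carrier_iff by blast
  obtain y where y: "y \<in> ext_space A \<Phi>" "Y = cls A \<Phi> y" using assms(2) carrier_iff by blast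
  have "cls A \<Phi> (\<lambda>g. x' g + y' g) = cls A \<Phi> (\<lambda>g. x g + y g)" if "x' \<in> X" "y' \<in> Y" for x' y'
  proof -
    have x': "x' \<in> ext_space A \<Phi>" "hat x' = hat x" using that(1) x by (simp_all add: cls_eq)
    have y': "y' \<in> ext_space A \<Phi>" "hat y' = hat y" using that(2) y by (simp_all add: cls_eq)
    show ?thesis
      unfolding cls_eq[OF ext_add(1)[OF x'(1) y'(1)]] cls_eq[OF ext_add(1)[OF x(1) y(1)]]
        ext_add(2)[OF x'(1) y'(1)] ext_add(2)[OF x(1) y(1)] x'(2) y'(2) by (rule refl)
  qed
  then have "(\<Union>x'\<in>X. \<Union>y'\<in>Y. cls A \<Phi> (\<lambda>g. x' g + y' g)) = (\<Union>x'\<in>X. \<Union>y'\<in>Y. cls A \<Phi> (\<lambda>g. x g + y g))"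
    by (intro SUP_cong refl)
  moreover have "X \<noteq> {}" "Y \<noteq> {}" using x y by (auto simp: cls_eq)
  ultimately have "vadd (pair_space A \<Phi>) X Y = cls A \<Phi> (\<lambda>g. x g + y g)"
    by (simp add: pair_space_def)
  then show "vadd (pair_space A \<Phi>) X Y \<in> carrier (pair_space A \<Phi>)"
    and "val (vadd (pair_space A \<Phi>) X Y) = val X + val Y"
    using ext_add[OF x(1) y(1)] by (auto simp: carrier_iff val_cls x y)
qed

lemma vscale_pair_space:
  assumes "X \<in> carrier (pair_space A \<Phi>)"
  shows "vscale (pair_space A \<Phi>) c X \<in> carrier (pair_space A \<Phi>)"
    and "val (vscale (pair_space A \<Phi>) c X) = c *\<^sub>C val X"
proof -
  obtain x where x: "x \<in> ext_space A \<Phi>" "X = cls A \<Phi> x"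
    using assms carrier_iff by blast
  have "cls A \<Phi> (\<lambda>g. c *\<^sub>C x' g) = cls A \<Phi> (\<lambda>g. c *\<^sub>C x g)" if "x' \<in> X" for x'
    using that x by (simp add: cls_eq ext_scaleC)
  then have "(\<Union>x'\<in>X. cls A \<Phi> (\<lambda>g. c *\<^sub>C x' g)) = (\<Union>x'\<in>X. cls A \<Phi> (\<lambda>g. c *\<^sub>C x g))"
    by (intro SUP_cong refl)
  moreover have "X \<noteq> {}" using x by (auto simp: cls_eq)
  ultimately have "vscale (pair_space A \<Phi>) c X = cls A \<Phi> (\<lambda>g. c *\<^sub>C x g)"
    by (simp add: pair_space_def)
  then show "vscale (pair_space A \<Phi>) c X \<in> carrier (pair_space A \<Phi>)"
    and "val (vscale (pair_space A \<Phi>) c X) = c *\<^sub>C val X"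
    using ext_scaleC[OF x(1)] by (auto simp: carrier_iff val_cls x)
qed

lemma vinner_pair_space:
  assumes "X \<in> carrier (pair_space A \<Phi>)" "Y \<in> carrier (pair_space A \<Phi>)"
  shows "vinner (pair_space A \<Phi>) X Y = cinner (val X) (val Y)"
proof -
  obtain x where x: "x \<in> ext_space A \<Phi>" "X = cls A \<Phi> x" using assms(1) carrier_iff by blast
  obtain y where y: "y \<in> ext_space A \<Phi>" "Y = cls A \<Phi> y" using assms(2) carrier_iff by blast
  have "lim (avg_inner \<Phi> x' y') = cinner (hat x) (hat y)" if "x' \<in> X" "y' \<in> Y" for x' y'
  proof -
    have "x' \<in> ext_space A \<Phi>" "hat x' = hat x" "y' \<in> ext_space A \<Phi>" "hat y' = hat y"
      using that x y by (simp_all add: cls_eq)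
    then show ?thesis using limI[OF img_inner[OF img_hat img_hat], of x' y'] by simp
  qed
  then have "(\<Union>x'\<in>X. \<Union>y'\<in>Y. {lim (avg_inner \<Phi> x' y')}) = (\<Union>x'\<in>X. \<Union>y'\<in>Y. {cinner (hat x) (hat y)})"
    by (intro SUP_cong refl) metis
  also have "\<dots> = {cinner (hat x) (hat y)}"
  proof -
    have "X \<noteq> {}" "Y \<noteq> {}" using x y by (auto simp: cls_eq)
    then show ?thesis by simp
  qed
  finally have "vinner (pair_space A \<Phi>) X Y = cinner (hat x) (hat y)"
    by (simp add: pair_space_def)
  then show ?thesis unfolding x(2) y(2) val_cls[OF x(1)] val_cls[OF y(1)] .
qed

text \<open>The inverse of \<open>val\<close>, meaningful on \<open>target\<close>.\<close>

definition pick :: "'b \<Rightarrow> ('g \<Rightarrow> 'h) set" where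
  "pick w = cls A \<Phi> (SOME E. img E w)"

lemma pick:
  assumes "w \<in> target"
  shows "pick w \<in> carrier (pair_space A \<Phi>)" and "val (pick w) = w"
proof -
  have "img (SOME E. img E w) w" using assms unfolding target_def by (auto intro: someI[where P = "\<lambda>E. img E w"])
  then show "pick w \<in> carrier (pair_space A \<Phi>)" "val (pick w) = w"
    unfolding pick_def using img_imp_ext hat_eq by (auto simp: carrier_iff val_cls)
qed

lemma pick_val: "X \<in> carrier (pair_space A \<Phi>) \<Longrightarrow> pick (val X) = X"
  by (rule val_inj) (simp_all add: pick val_target)

text \<open>Conjugation of a unitary by \<open>val\<close>. Invariance of \<open>target\<close>
  under both L and its inverse L' makes the conjugate a bijection of the classes.\<close>

lemma unitary_map_pick:
  assumes add: "\<And>a b. L (a + b) = L a + L b"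
    and scale: "\<And>c a. L (c *\<^sub>C a) = c *\<^sub>C L a"
    and inner: "\<And>a b. cinner (L a) (L b) = cinner a b"
    and inv: "\<And>a. L (L' a) = a" "\<And>a. L' (L a) = a"
    and target: "\<And>w. w \<in> target \<Longrightarrow> L w \<in> target" "\<And>w. w \<in> target \<Longrightarrow> L' w \<in> target"
  shows "unitary_map (pair_space A \<Phi>) (pair_space A \<Phi>) (\<lambda>X. pick (L (val X)))"
  unfolding unitary_map_def
proof (intro conjI allI ballI)
  let ?K = "pair_space A \<Phi>"
  have mem: "pick (L (val X)) \<in> carrier ?K" "val (pick (L (val X))) = L (val X)" if "X \<in> carrier ?K" for X
    using pick[OF target(1)[OF val_target[OF that]]] by auto
  have mem': "pick (L' (val X)) \<in> carrier ?K" "val (pick (L' (val X))) = L' (val X)" if "X \<in> carrier ?K" for X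
    using pick[OF target(2)[OF val_target[OF that]]] by auto
  show "bij_betw (\<lambda>X. pick (L (val X))) (carrier ?K) (carrier ?K)"
    by (rule bij_betw_byWitness[where f' = "\<lambda>X. pick (L' (val X))"])
      (auto simp: mem mem' inv pick_val)
  fix X assume X: "X \<in> carrier ?K"
  show "pick (L (val (vscale ?K c X))) = vscale ?K c (pick (L (val X)))" for c
  proof (rule val_inj)
    note Xc = vscale_pair_space[OF X, of c] and LX = vscale_pair_space[OF mem(1)[OF X], of c]
    show "pick (L (val (vscale ?K c X))) \<in> carrier ?K" by (rule mem(1)[OF Xc(1)])
    show "vscale ?K c (pick (L (val X))) \<in> carrier ?K" by (rule LX(1))
    show "val (pick (L (val (vscale ?K c X)))) = val (vscale ?K c (pick (L (val X))))"
      unfolding mem(2)[OF Xc(1)] LX(2) unfolding Xc(2) mem(2)[OF X] by (rule scale)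
  qed
  fix Y assume Y: "Y \<in> carrier ?K"
  show "pick (L (val (vadd ?K X Y))) = vadd ?K (pick (L (val X))) (pick (L (val Y)))"
  proof (rule val_inj)
    note XY = vadd_pair_space[OF X Y] and LXY = vadd_pair_space[OF mem(1)[OF X] mem(1)[OF Y]]
    show "pick (L (val (vadd ?K X Y))) \<in> carrier ?K" by (rule mem(1)[OF XY(1)])
    show "vadd ?K (pick (L (val X))) (pick (L (val Y))) \<in> carrier ?K" by (rule LXY(1))
    show "val (pick (L (val (vadd ?K X Y)))) = val (vadd ?K (pick (L (val X))) (pick (L (val Y))))"
      unfolding mem(2)[OF XY(1)] LXY(2) unfolding XY(2) mem(2)[OF X] mem(2)[OF Y] by (rule add)
  qed
  show "vinner ?K (pick (L (val X))) (pick (L (val Y))) = vinner ?K X Y"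
    unfolding vinner_pair_space[OF X Y] vinner_pair_space[OF mem(1)[OF X] mem(1)[OF Y]]
      mem(2)[OF X] mem(2)[OF Y] by (rule inner)
qed

end

section \<open>Averages along right-Folner sequences\<close>

lemma right_folner_subseq:
  assumes "right_folner F" "strict_mono N"
  shows "right_folner (F \<circ> N)"
  unfolding right_folner_def
proof (intro conjI allI)
  fix g
  have "(\<lambda>n. real (card (sym_diff (F n) ((\<lambda>x. x + g) ` F n))) / real (card (F n))) \<longlonglongrightarrow> 0"
    using assms(1) unfolding right_folner_def by blast
  from LIMSEQ_subseq_LIMSEQ[OF this assms(2)]
  show "(\<lambda>n. real (card (sym_diff ((F \<circ> N) n) ((\<lambda>x. x + g) ` (F \<circ> N) n))) / real (card ((F \<circ> N) n))) \<longlonglongrightarrow> 0"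
    by (simp add: o_def)
qed (use assms in \<open>auto simp: right_folner_def\<close>)

text \<open>Take m + 1 group elements, each moving F n by a proportion below 1/(m + 1). If F n had
  at most m points, fewer than one point would be moved, so F n would contain all m + 1 right
  translates of any of its points.\<close>

lemma right_folner_card_at_top:
  fixes F :: "nat \<Rightarrow> 'g::group_add set"
  assumes F: "right_folner F" and inf: "infinite (UNIV :: 'g set)"
  shows "filterlim (\<lambda>n. real (card (F n))) at_top sequentially"
  unfolding filterlim_at_top
proof
  fix Z :: real
  obtain m :: nat where m: "Z \<le> real m" using real_arch_simple by blast
  obtain K :: "'g set" where K: "finite K" "card K = Suc m"
    using infinite_arbitrarily_large[OF inf] by metis
  have "\<forall>\<^sub>F n in sequentially. real (card (sym_diff (F n) ((\<lambda>x. x + g) ` F n))) / real (card (F n))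
      < 1 / real (Suc m)" for g
  proof (rule order_tendstoD(2))
    show "(\<lambda>n. real (card (sym_diff (F n) ((\<lambda>x. x + g) ` F n))) / real (card (F n))) \<longlonglongrightarrow> 0"
      using F unfolding right_folner_def by blast
  qed simp
  then have "\<forall>\<^sub>F n in sequentially. \<forall>g\<in>K. real (card (sym_diff (F n) ((\<lambda>x. x + g) ` F n))) / real (card (F n))
      < 1 / real (Suc m)"
    by (intro eventually_ball_finite K) blast
  then show "\<forall>\<^sub>F n in sequentially. Z \<le> real (card (F n))"
  proof eventually_elim
    case (elim n)
    have fin: "finite (F n)" "F n \<noteq> {}" using F unfolding right_folner_def by auto
    then have pos: "0 < real (card (F n))" by (simp add: card_gt_0_iff)
    have "Suc m \<le> card (F n)"
    proof (rule ccontr)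
      assume less: "\<not> Suc m \<le> card (F n)"
      have sub: "(\<lambda>x. x + g) ` F n \<subseteq> F n" if "g \<in> K" for g
      proof -
        have "real (card (sym_diff (F n) ((\<lambda>x. x + g) ` F n))) < real (card (F n)) / real (Suc m)"
          using bspec[OF elim that] pos by (simp add: pos_divide_less_eq)
        also have "\<dots> \<le> 1" using less by simp
        finally have "card (sym_diff (F n) ((\<lambda>x. x + g) ` F n)) = 0" by simp
        then show ?thesis using fin by auto
      qed
      obtain x where x: "x \<in> F n" using fin by blast
      have "(\<lambda>g. x + g) ` K \<subseteq> F n" using sub x by blast
      then have "card ((\<lambda>g. x + g) ` K) \<le> card (F n)" using fin by (intro card_mono)
      moreover have "card ((\<lambda>g. x + g) ` K) = card K" by (intro card_image) (auto simp: inj_on_def)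
      ultimately show False using less K by simp
    qed
    then show ?case using m by linarith
  qed
qed

text \<open>After reindexing, the two sums differ only on the symmetric difference of F n and its
  translate.\<close>

lemma right_folner_avg_shift:
  fixes f :: "'g::group_add \<Rightarrow> complex"
  assumes F: "right_folner F" and B: "\<And>x. cmod (f x) \<le> B"
  shows "(\<lambda>n. avg (F n) (\<lambda>x. f (x + k)) - avg (F n) f) \<longlonglongrightarrow> 0"
proof (rule Lim_null_comparison)
  let ?r = "\<lambda>n. real (card (sym_diff (F n) ((\<lambda>x. x + k) ` F n))) / real (card (F n))"
  have "(\<lambda>n. B * ?r n) \<longlonglongrightarrow> B * 0"
    using F unfolding right_folner_def by (intro tendsto_intros) blast
  then show "(\<lambda>n. B * ?r n) \<longlonglongrightarrow> 0" by simp
  show "\<forall>\<^sub>F n in sequentially. norm (avg (F n) (\<lambda>x. f (x + k)) - avg (F n) f) \<le> B * ?r n"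
  proof (rule always_eventually, rule allI)
    fix n
    define S where "S = F n"
    define S' where "S' = (\<lambda>x. x + k) ` S"
    have fin: "finite S" "finite S'" using F by (auto simp: S_def S'_def right_folner_def)
    have "(\<Sum>x\<in>S. f (x + k)) = (\<Sum>y\<in>S'. f y)"
      unfolding S'_def by (subst sum.reindex) (auto simp: inj_on_def)
    also have "\<dots> = (\<Sum>y\<in>S' - S. f y) + (\<Sum>y\<in>S' \<inter> S. f y)"
      using sum.Int_Diff[OF fin(2), of f S] by (simp add: add.commute)
    also have "(\<Sum>y\<in>S' \<inter> S. f y) = (\<Sum>y\<in>S. f y) - (\<Sum>y\<in>S - S'. f y)"
      using sum.Int_Diff[OF fin(1), of f S'] by (simp add: Int_commute)
    finally have "(\<Sum>x\<in>S. f (x + k)) - (\<Sum>y\<in>S. f y) = (\<Sum>y\<in>S' - S. f y) - (\<Sum>y\<in>S - S'. f y)" by simp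
    also have "cmod \<dots> \<le> B * card (S' - S) + B * card (S - S')"
      using sum_norm_bound[of "S' - S" f B] sum_norm_bound[of "S - S'" f B] B
        norm_triangle_ineq4[of "\<Sum>y\<in>S' - S. f y" "\<Sum>y\<in>S - S'. f y"]
      by (simp add: mult.commute)
    also have "\<dots> = B * card (sym_diff S S')"
      using fin by (subst card_Un_disjoint) (auto simp: distrib_left)
    finally have "cmod ((\<Sum>x\<in>S. f (x + k)) - (\<Sum>y\<in>S. f y)) \<le> B * card (sym_diff S S')" .
    then show "norm (avg (F n) (\<lambda>x. f (x + k)) - avg (F n) f) \<le> B * ?r n"
      unfolding avg_def S_def[symmetric] S'_def[symmetric] diff_divide_distrib[symmetric]
      by (simp add: norm_divide divide_right_mono)
  qed
qed

section \<open>Limits of averaged inner products on the span of the translates\<close>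

lemma avg_inner_add_left: "avg_inner \<Phi> (\<lambda>g. x g + y g) z q = avg_inner \<Phi> x z q + avg_inner \<Phi> y z q"
  by (simp add: avg_inner_def avg_def cinner_add_left sum.distrib add_divide_distrib)

lemma avg_inner_scaleC_left: "avg_inner \<Phi> (\<lambda>g. c *\<^sub>C x g) z q = c * avg_inner \<Phi> x z q"
  by (simp add: avg_inner_def avg_def cinner_scaleC_left sum_distrib_left)

lemma avg_inner_commute: "avg_inner \<Phi> x y q = cnj (avg_inner \<Phi> y x q)"
  by (simp add: avg_inner_def avg_def cinner_commute[of "x _"])

lemma avg_inner_self: "avg_inner \<Phi> x x q = complex_of_real ((rms (\<Phi> q) x)\<^sup>2)"
  by (simp add: avg_inner_def avg_def rms_square cinner_self)

text \<open>The limiting counterpart of \<open>cinner_comb\<close>: equal Gram forms on both sides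
  are what makes the map between the two spans isometric.\<close>

lemma tendsto_avg_inner_comb:
  fixes v w :: "'g \<Rightarrow> 'i::group_add \<Rightarrow> 'h::complex_inner"
  assumes "\<And>g h. avg_inner \<Phi> (\<lambda>x. v x g) (\<lambda>x. w x h) \<longlonglongrightarrow> \<phi> (- h + g)"
  shows "avg_inner \<Phi> (\<lambda>x. comb (v x) l) (\<lambda>x. comb (w x) l') \<longlonglongrightarrow> gram \<phi> l l'"
proof (induction l)
  case Nil
  then show ?case by (simp add: gram_def avg_inner_def avg_def)
next
  case (Cons p l)
  obtain a g where p: "p = (a, g)" by force
  have "avg_inner \<Phi> (\<lambda>x. v x g) (\<lambda>x. comb (w x) l') \<longlonglongrightarrow> (\<Sum>(b, h)\<leftarrow>l'. cnj b * \<phi> (- h + g))"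
  proof (induction l')
    case Nil
    then show ?case by (simp add: avg_inner_def avg_def)
  next
    case (Cons r l')
    obtain b h where r: "r = (b, h)" by force
    have "avg_inner \<Phi> (\<lambda>x. v x g) (\<lambda>x. comb (w x) (r # l')) = (\<lambda>q. cnj b * avg_inner \<Phi> (\<lambda>x. v x g) (\<lambda>x. w x h) q
        + avg_inner \<Phi> (\<lambda>x. v x g) (\<lambda>x. comb (w x) l') q)"
      by (rule ext, subst (1 2 3) avg_inner_commute)
        (simp add: r comb_Cons avg_inner_add_left avg_inner_scaleC_left)
    then show ?case using tendsto_add[OF tendsto_mult[OF tendsto_const assms[of g h]] Cons] by (simp add: r)
  qed
  then have "(\<lambda>q. a * avg_inner \<Phi> (\<lambda>x. v x g) (\<lambda>x. comb (w x) l') q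
      + avg_inner \<Phi> (\<lambda>x. comb (v x) l) (\<lambda>x. comb (w x) l') q)
      \<longlonglongrightarrow> a * (\<Sum>(b, h)\<leftarrow>l'. cnj b * \<phi> (- h + g)) + gram \<phi> l l'"
    by (intro tendsto_intros Cons)
  then show ?case
    by (simp add: p comb_Cons avg_inner_add_left[abs_def] avg_inner_scaleC_left gram_def
        sum_list_const_mult[symmetric] case_prod_unfold mult.assoc)
qed

lemma pre_space_shifts:
  fixes u :: "'g::group_add \<Rightarrow> 'h::complex_inner"
  shows "x \<in> pre_space (range (\<lambda>g. shift g u)) \<longleftrightarrow> (\<exists>l. x = (\<lambda>y. comb (\<lambda>g. u (y + g)) l))"
proof
  assume "x \<in> pre_space (range (\<lambda>g. shift g u))"
  then show "\<exists>l. x = (\<lambda>y. comb (\<lambda>g. u (y + g)) l)"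
    unfolding pre_space_def
  proof (induction rule: cfun.span_induct_alt)
    case base
    show ?case by (rule exI[of _ "[]"]) (simp add: fun_eq_iff)
  next
    case (step c a b)
    then obtain g l where "a = shift g u" "b = (\<lambda>y. comb (\<lambda>g. u (y + g)) l)" by blast
    then show ?case
      by (intro exI[of _ "(c, g) # l"]) (simp add: comb_Cons fun_eq_iff fun_scaleC_def shift_def)
  qed
next
  assume "\<exists>l. x = (\<lambda>y. comb (\<lambda>g. u (y + g)) l)"
  then obtain l where x: "x = (\<lambda>y. comb (\<lambda>g. u (y + g)) l)" by blast
  have "(\<lambda>y. comb (\<lambda>g. u (y + g)) l) \<in> cfun.span (range (\<lambda>g. shift g u))"
  proof (induction l)
    case Nil
    then show ?case using cfun.span_zero by (simp add: zero_fun_def)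
  next
    case (Cons p l)
    obtain a g where p: "p = (a, g)" by force
    have "(\<lambda>y. comb (\<lambda>g. u (y + g)) (p # l)) = fun_scaleC a (shift g u) + (\<lambda>y. comb (\<lambda>g. u (y + g)) l)"
      by (simp add: p comb_Cons fun_eq_iff fun_scaleC_def shift_def)
    then show ?case using Cons by (simp add: cfun.span_add cfun.span_scale cfun.span_base)
  qed
  then show "x \<in> pre_space (range (\<lambda>g. shift g u))" by (simp add: x pre_space_def)
qed

text \<open>A limit along a subsequence is at most the limsup along the full sequence, so all finite
  partial sums stay below the assumed total.\<close>

lemma square_summable_subsequence_limits:
  fixes c :: "nat \<Rightarrow> 'g \<Rightarrow> complex"
  assumes lim: "\<And>h. (\<lambda>q. c (N q) h) \<longlonglongrightarrow> \<phi> h" and N: "strict_mono N"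
    and sum: "(\<Sum>\<^sub>\<infinity>h. limsup (\<lambda>n. ennreal ((cmod (c n h))\<^sup>2))) < \<infinity>"
  shows "(\<lambda>h. (cmod (\<phi> h))\<^sup>2) summable_on UNIV"
proof -
  define L where "L = (\<lambda>h. limsup (\<lambda>n. ennreal ((cmod (c n h))\<^sup>2)))"
  have le: "ennreal ((cmod (\<phi> h))\<^sup>2) \<le> L h" for h
  proof -
    have "(\<lambda>q. ennreal ((cmod (c (N q) h))\<^sup>2)) \<longlonglongrightarrow> ennreal ((cmod (\<phi> h))\<^sup>2)"
      by (intro tendsto_ennrealI tendsto_intros lim)
    from lim_imp_Limsup[OF sequentially_bot this]
    have "ennreal ((cmod (\<phi> h))\<^sup>2) = limsup ((\<lambda>n. ennreal ((cmod (c n h))\<^sup>2)) \<circ> N)"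
      by (simp only: o_def)
    also have "\<dots> \<le> L h" unfolding L_def by (rule limsup_subseq_mono[OF N])
    finally show ?thesis .
  qed
  have "(\<Sum>h\<in>K. (cmod (\<phi> h))\<^sup>2) \<le> enn2real (infsum L UNIV)" if "finite K" for K
  proof -
    have "ennreal (\<Sum>h\<in>K. (cmod (\<phi> h))\<^sup>2) = (\<Sum>h\<in>K. ennreal ((cmod (\<phi> h))\<^sup>2))"
      by (rule sum_ennreal[symmetric]) simp
    also have "\<dots> \<le> (\<Sum>h\<in>K. L h)" by (intro sum_mono le)
    also have "\<dots> \<le> infsum L UNIV"
      unfolding infsum_finite[OF that, symmetric]
      by (rule infsum_mono_neutral) (simp_all add: nonneg_summable_on_complete)
    finally have "enn2real (ennreal (\<Sum>h\<in>K. (cmod (\<phi> h))\<^sup>2)) \<le> enn2real (infsum L UNIV)"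
      using sum by (intro enn2real_mono) (simp_all add: L_def)
    then show ?thesis by (simp add: sum_nonneg)
  qed
  then show ?thesis
    by (intro nonneg_bdd_above_summable_on bdd_aboveI2[of _ _ "enn2real (infsum L UNIV)"]) auto
qed

section \<open>The record \<open>ell2\<close> expressed through the type \<open>l2\<close>\<close>

lemma carrier_ell2: "carrier ell2 = range l2_apply"
  by (simp add: ell2_def type_definition.Rep_range[OF type_definition_l2])

lemma
  shows vadd_ell2: "vadd ell2 (l2_apply a) (l2_apply b) = l2_apply (a + b)"
    and vscale_ell2: "vscale ell2 c (l2_apply a) = l2_apply (c *\<^sub>C a)"
    and vinner_ell2: "vinner ell2 (l2_apply a) (l2_apply b) = cinner a b"
  by (simp_all add: ell2_def plus_l2.rep_eq scaleC_l2.rep_eq cinner_l2.rep_eq)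

lemma vdist_ell2: "vdist ell2 (l2_apply a) (l2_apply b) = norm (a - b)"
  by (simp add: vdist_def Let_def vscale_ell2 vadd_ell2 vinner_ell2 norm_eq_sqrt_cinner)

lemma left_regular_l2_apply: "left_regular g (l2_apply a) = l2_apply (translate g a)"
  by (simp add: translate.rep_eq)

theorem theorem3p4:
  fixes F :: "nat \<Rightarrow> 'g :: group_add set"
    and u :: "'g \<Rightarrow> 'h :: {complex_inner, complete_space}"
  assumes "countable (UNIV :: 'g set)" and "infinite (UNIV :: 'g set)"
    and "amenable TYPE('g)"
    and "right_folner F"
    and "separable_space (euclidean :: 'h topology)"
    and "bounded (range u)"
    and "(\<Sum>\<^sub>\<infinity>h. limsup (\<lambda>N. ennreal ((cmod (avg (F N) (\<lambda>g. cinner (u (g + h)) (u g))))\<^sup>2))) < \<infinity>"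
  shows "spectrally_Lebesgue F u"
  unfolding spectrally_Lebesgue_def
proof (intro conjI allI impI)
  show "u \<in> UB" using assms(6) by (simp add: UB_def)
  fix N
  let ?A = "range (\<lambda>g. shift g u)"
  assume perm: "permissible F ?A N"
  define \<Phi> where "\<Phi> = F \<circ> N"
  have N: "strict_mono N" using perm unfolding permissible_def by blast
  have folner: "right_folner \<Phi>" unfolding \<Phi>_def by (rule right_folner_subseq[OF assms(4) N])
  have conv: "convergent (avg_inner \<Phi> (shift g u) (shift k u))" for g k
    using perm unfolding permissible_def \<Phi>_def by blast
  obtain B where B: "\<And>x. norm (u x) \<le> B" using assms(6) unfolding bounded_iff by blast
  define \<phi> where "\<phi> h = lim (avg_inner \<Phi> (shift h u) (shift 0 u))" for h
  have \<phi>: "avg_inner \<Phi> (shift h u) (shift 0 u) \<longlonglongrightarrow> \<phi> h" for h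
    unfolding \<phi>_def using conv convergent_LIMSEQ_iff by blast
  \<comment> \<open>With this f, f (x + k) is the inner product of u (x + g) and u (x + k), so
    invariance of averages under right translation by k turns the (g, k) correlation into the (k^-1
    g, 0) one. Boundedness of u makes f bounded.\<close>
  have limit: "avg_inner \<Phi> (shift g u) (shift k u) \<longlonglongrightarrow> \<phi> (- k + g)" for g k
  proof -
    define f where "f = (\<lambda>x. cinner (u (x + (- k + g))) (u x))"
    have bound: "cmod (f x) \<le> (B + B)\<^sup>2" for x
      unfolding f_def using B by (intro order_trans[OF cmod_cinner_le] power_mono add_mono) auto
    from right_folner_avg_shift[where f = f and k = k, OF folner bound]
    have "(\<lambda>n. avg_inner \<Phi> (shift g u) (shift k u) n - avg_inner \<Phi> (shift (- k + g) u) (shift 0 u) n) \<longlonglongrightarrow> 0"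
      by (simp add: f_def avg_inner_def shift_def add.assoc)
    from tendsto_add[OF this \<phi>[of "- k + g"]] show ?thesis by simp
  qed
  define T where "T l = (\<lambda>x. comb (\<lambda>g. u (x + g)) l)" for l
  have T_limit: "avg_inner \<Phi> (T l) (T l') \<longlonglongrightarrow> gram \<phi> l l'" for l l'
    unfolding T_def by (rule tendsto_avg_inner_comb) (use limit in \<open>simp add: shift_def\<close>)
  have "(\<lambda>h. (cmod (\<phi> h))\<^sup>2) summable_on UNIV"
  proof (rule square_summable_subsequence_limits[OF _ N assms(7)])
    show "(\<lambda>q. avg (F (N q)) (\<lambda>g. cinner (u (g + h)) (u g))) \<longlonglongrightarrow> \<phi> h" for h
      using \<phi>[of h] by (simp add: avg_inner_def[abs_def] \<Phi>_def shift_def)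
  qed
  moreover have "0 \<le> Re (gram \<phi> l l)" for l
    by (rule LIMSEQ_le_const[OF tendsto_Re[OF T_limit]]) (simp add: avg_inner_self)
  moreover have "\<phi> (- h) = cnj (\<phi> h)" for h
  proof (rule LIMSEQ_unique)
    show "avg_inner \<Phi> (shift 0 u) (shift h u) \<longlonglongrightarrow> \<phi> (- h)" using limit[of 0 h] by simp
    have "(\<lambda>q. cnj (avg_inner \<Phi> (shift h u) (shift 0 u) q)) \<longlonglongrightarrow> cnj (\<phi> h)"
      by (intro tendsto_intros \<phi>)
    then show "avg_inner \<Phi> (shift 0 u) (shift h u) \<longlonglongrightarrow> cnj (\<phi> h)"
      by (simp flip: avg_inner_commute)
  qed
  ultimately obtain \<psi> where \<psi>: "\<And>h. cinner (translate h \<psi>) \<psi> = \<phi> h"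
    by (rule positive_definite_square_summable_coefficient) blast
  define S where "S l = comb (\<lambda>g. translate g \<psi>) l" for l
  have S_gram: "cinner (S l) (S l') = gram \<phi> l l'" for l l'
    unfolding S_def
  proof (rule cinner_comb)
    fix g h
    show "cinner (translate g \<psi>) (translate h \<psi>) = \<phi> (- h + g)"
      using cinner_translate[of "- h" "translate g \<psi>" "translate h \<psi>"] by (simp add: translate_translate \<psi>)
  qed
  \<comment> \<open>T l and S l have the same Gram form, the former in the limit of averages, the
    latter exactly; this is the isometry of the model.\<close>
  define R where "R = range (\<lambda>l. (T l, S l))"
  interpret isometric_model \<Phi> ?A R
  proof
    show "finite (\<Phi> q)" for q using folner unfolding right_folner_def by blast
    show "filterlim (\<lambda>q. real (card (\<Phi> q))) at_top sequentially"
      by (rule right_folner_card_at_top[OF folner assms(2)])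
    show "x \<in> pre_space ?A \<longleftrightarrow> (\<exists>s. (x, s) \<in> R)" for x
      unfolding pre_space_shifts by (auto simp: R_def T_def)
    show "(\<lambda>g. x g + y g, s + t) \<in> R" if xy: "(x, s) \<in> R" "(y, t) \<in> R" for x s y t
    proof -
      obtain l l' where "x = T l" "s = S l" "y = T l'" "t = S l'" using xy unfolding R_def by blast
      then have "(\<lambda>g. x g + y g, s + t) = (T (l @ l'), S (l @ l'))" by (simp add: T_def S_def comb_append)
      then show ?thesis unfolding R_def by blast
    qed
    fix x s assume "(x, s) \<in> R"
    then obtain l where l: "x = T l" "s = S l" unfolding R_def by blast
    show "(\<lambda>g. c *\<^sub>C x g, c *\<^sub>C s) \<in> R" for c
    proof -
      have "(\<lambda>g. c *\<^sub>C x g, c *\<^sub>C s) = (T (map (\<lambda>(a, g). (c * a, g)) l), S (map (\<lambda>(a, g). (c * a, g)) l))"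
        by (simp add: T_def S_def comb_scale l)
      then show ?thesis unfolding R_def by blast
    qed
    have "(\<lambda>q. sqrt (Re (avg_inner \<Phi> x x q))) \<longlonglongrightarrow> sqrt (Re (cinner s s))"
      unfolding l S_gram by (intro tendsto_intros T_limit)
    then show "(\<lambda>q. rms (\<Phi> q) x) \<longlonglongrightarrow> norm s"
      by (simp add: avg_inner_self rms_nonneg norm_eq_sqrt_cinner)
  qed
  \<comment> \<open>Both sides replace g by h + g in the list: (x + h) + g = x + (h + g), and L(h)
    L(g) = L(h + g). So R intertwines \<open>shift\<close> with \<open>translate\<close>.\<close>
  have R_translate: "(shift h x, translate h s) \<in> R" if "(x, s) \<in> R" for h x s
  proof -
    obtain l where "x = T l" "s = S l" using \<open>(x, s) \<in> R\<close> unfolding R_def by blast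
    then have "(shift h x, translate h s) = (T (map (\<lambda>(a, g). (a, h + g)) l), S (map (\<lambda>(a, g). (a, h + g)) l))"
      by (simp add: T_def S_def shift_def comb_reindex translate_comb translate_translate add.assoc)
    then show ?thesis unfolding R_def by blast
  qed
  have target_translate: "translate h w \<in> target" if w: "w \<in> target" for h w
    unfolding target_iff
  proof (intro allI impI)
    fix e :: real assume "0 < e"
    then obtain x s where xs: "(x, s) \<in> R" "norm (s - w) < e" using w unfolding target_iff by blast
    have "translate h s - translate h w = translate h (s - w)"
      by (rule linear_diff[symmetric, OF bounded_linear.linear[OF bounded_linear_translate]])
    then have "norm (translate h s - translate h w) < e" using xs by (simp add: norm_translate)
    with R_translate[OF xs(1)] show "\<exists>x s. (x, s) \<in> R \<and> norm (s - translate h w) < e" by blast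
  qed
  let ?K = "pair_space ?A \<Phi>"
  \<comment> \<open>The representation is transported from \<open>l2\<close> along
    \<open>val\<close>, since \<open>shift\<close> itself need not act on \<open>ext_space\<close>;
    on classes of the span the two agree because R intertwines them.\<close>
  define U where "U g X = pick (translate g (val X))" for g X
  have U: "U g X \<in> carrier ?K" "val (U g X) = translate g (val X)" if "X \<in> carrier ?K" for g X
    using pick[OF target_translate[OF val_target[OF that]]] by (simp_all add: U_def)
  have unitary: "unitary_map ?K ?K (U g)" for g
    unfolding U_def
    by (rule unitary_map_pick[where L' = "translate (- g)"])
      (simp_all add: translate_add translate_scaleC cinner_translate translate_translate target_translate)
  have "U (g + h) X = U g (U h X)" if X: "X \<in> carrier ?K" for g h X
    by (rule val_inj[OF U(1)[OF X] U(1)[OF U(1)[OF X]]])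
      (simp only: U(2)[OF X] U(2)[OF U(1)[OF X]] translate_translate)
  with unitary have "unitary_rep ?K U" unfolding unitary_rep_def by blast
  moreover have "U h (cls ?A \<Phi> x) = cls ?A \<Phi> (shift h x)" if "x \<in> pre_space ?A" for h x
  proof -
    obtain s where s: "(x, s) \<in> R" using \<open>x \<in> pre_space ?A\<close> Domain_R by blast
    note 1 = img_R[OF s] and 2 = img_R[OF R_translate[OF s, of h]]
    have c: "cls ?A \<Phi> x \<in> carrier ?K" "cls ?A \<Phi> (shift h x) \<in> carrier ?K"
      using img_imp_ext[OF 1] img_imp_ext[OF 2] carrier_iff by blast+
    show ?thesis
    proof (rule val_inj[OF U(1)[OF c(1)] c(2)])
      show "val (U h (cls ?A \<Phi> x)) = val (cls ?A \<Phi> (shift h x))"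
        unfolding U(2)[OF c(1)] val_cls[OF img_imp_ext[OF 1]] val_cls[OF img_imp_ext[OF 2]]
          hat_eq[OF 1] hat_eq[OF 2] by (rule refl)
    qed
  qed
  ultimately have induced: "induced_rep ?A \<Phi> U" unfolding induced_rep_def by blast
  define W where "W = l2_apply ` target"
  have "closed_subspace ell2 W"
    unfolding closed_subspace_def
  proof (intro conjI ballI allI impI)
    show "W \<subseteq> carrier ell2" by (auto simp: W_def carrier_ell2)
    have "S [] \<in> target" unfolding target_def using img_R[of "T []" "S []"] by (auto simp: R_def)
    then show "W \<noteq> {}" by (auto simp: W_def)
    fix x assume "x \<in> W"
    then obtain a where a: "x = l2_apply a" "a \<in> target" by (auto simp: W_def)
    show "vscale ell2 c x \<in> W" for c
      unfolding a(1) vscale_ell2 W_def using target_scaleC[OF a(2)] by blast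
    fix y assume "y \<in> W"
    then obtain b where b: "y = l2_apply b" "b \<in> target" by (auto simp: W_def)
    show "vadd ell2 x y \<in> W"
      unfolding a(1) b(1) vadd_ell2 W_def using target_add[OF a(2) b(2)] by blast
  next
    fix s :: "nat \<Rightarrow> 'g \<Rightarrow> complex" and x
    assume *: "(\<forall>n. s n \<in> W) \<and> x \<in> carrier ell2 \<and> (\<lambda>n. vdist ell2 (s n) x) \<longlonglongrightarrow> 0"
    then obtain a where a: "x = l2_apply a" by (auto simp: carrier_ell2)
    have "a \<in> target"
    proof (rule target_closed)
      fix e :: real assume "0 < e"
      then have "\<forall>\<^sub>F n in sequentially. vdist ell2 (s n) x < e" using * order_tendstoD(2) by blast
      then obtain n where n: "vdist ell2 (s n) x < e" using eventually_happens' sequentially_bot by blast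
      obtain b where b: "s n = l2_apply b" "b \<in> target" using * unfolding W_def by blast
      then show "\<exists>w'\<in>target. norm (w' - a) < e" using n unfolding a b(1) vdist_ell2 by blast
    qed
    then show "x \<in> W" using a by (simp add: W_def)
  qed
  moreover have "left_regular g ` W \<subseteq> W" for g
    using target_translate by (auto simp: W_def left_regular_l2_apply)
  ultimately have inv: "invariant_subspace ell2 left_regular W" unfolding invariant_subspace_def by blast
  \<comment> \<open>The intertwiner is \<open>val\<close> read in the record; it is onto W because
    \<open>pick\<close> provides a class over each element of \<open>target\<close>.\<close>
  have "unitary_map ?K (ell2\<lparr>carrier := W\<rparr>) (\<lambda>X. l2_apply (val X))"
    unfolding unitary_map_def
  proof (intro conjI allI ballI)
    show "bij_betw (\<lambda>X. l2_apply (val X)) (carrier ?K) (carrier (ell2\<lparr>carrier := W\<rparr>))"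
      unfolding bij_betw_def
    proof
      show "inj_on (\<lambda>X. l2_apply (val X)) (carrier ?K)"
        by (rule inj_onI) (simp add: l2_apply_inject val_inj)
      have "val ` carrier ?K = target"
      proof (intro equalityI subsetI)
        show "w \<in> target" if "w \<in> val ` carrier ?K" for w using that val_target by blast
        show "w \<in> val ` carrier ?K" if "w \<in> target" for w
          by (rule image_eqI[where x = "pick w"]) (simp_all add: pick that)
      qed
      moreover have "(\<lambda>X. l2_apply (val X)) ` carrier ?K = l2_apply ` val ` carrier ?K"
        by (simp only: image_image)
      ultimately show "(\<lambda>X. l2_apply (val X)) ` carrier ?K = carrier (ell2\<lparr>carrier := W\<rparr>)"
        by (simp add: W_def)
    qed
  qed (simp_all add: vadd_ell2 vscale_ell2 vinner_ell2 vadd_pair_space vscale_pair_space vinner_pair_space)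
  moreover have "l2_apply (val (U g X)) = left_regular g (l2_apply (val X))" if "X \<in> carrier ?K" for g X
    using U(2)[OF that] by (simp add: left_regular_l2_apply)
  ultimately have "unitarily_equivalent ?K U (ell2\<lparr>carrier := W\<rparr>) left_regular"
    unfolding unitarily_equivalent_def by blast
  then have "equivalent_to_subrep ?K U ell2 left_regular"
    unfolding equivalent_to_subrep_def using inv by blast
  then show "\<exists>U. induced_rep ?A (F \<circ> N) U \<and> equivalent_to_subrep (pair_space ?A (F \<circ> N)) U ell2 left_regular"
    using induced unfolding \<Phi>_def by blast
qed

end
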